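(* Let $p\in(1,\infty)$. There is a real sequence $(\delta_m)$ with $\delta_m\le 1$ and $\delta_m\to0$ as $m\to\infty$ (the term denoted $o(1)$) such that for every integer $m\ge1$ for which $mp$ is an even integer, the Daubechies orthonormal wavelet $\psi_m^D$ of order $m$ satisfies $$G\le\left(\int_{\mathbb{R}}|\omega|^{-mp}\,\bigl|\widehat{\psi_m^D}(\omega)\bigr|^p\,d\omega\right)^{1/p}\le F,$$ where $F,G\ge0$ are given by $$F^p=\frac{2^{1-p/2}}{\pi^{p(m+1/2)-1}(mp-1)}+\frac{2^{1-p(2m-1)}}{\pi^{p/2-1}(mp-1)!}\sum_{i=0}^{\lfloor mp/2\rfloor}(-1)^i\frac{(mp)!}{(mp-i)!\,i!}(mp-2i)^{mp-1}$$ and $$G^p=\frac{(1-\delta_m)\,2^{1-2pm}\,(2m)!}{\pi^{p/2-1}\,m^{p/2}\,3^{mp}\,m!\,(m-1)!}.$$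
   Context: The Fourier transform is $\hat f(\omega)=\frac{1}{\sqrt{2\pi}}\int_{\mathbb{R}}f(x)e^{-i\omega x}\,dx$. For a function $f$ and an integer $k\ge0$, ${}_kf$ denotes the function with $\widehat{{}_kf}(\omega)=(i\omega)^{-k}\hat f(\omega)$, so the middle quantity in the claim is $\|\widehat{{}_m(\psi_m^D)}\|_{L_p(\mathbb{R})}$ (the case $k=m$). For $m\in\mathbb{N}$, the Daubechies filter of order $m$ is a trigonometric polynomial $H_m(\omega)=2^{-1/2}\sum_{\ell=0}^{2m-1}h_m(\ell)e^{i\ell\omega}$ with real coefficients $h_m(\ell)$, satisfying $|H_m(\omega)|^2=\left(\cos^2\frac{\omega}{2}\right)^m P_{m-1}\left(\sin^2\frac{\omega}{2}\right)$, where $P_{m-1}(x)=\sum_{k=0}^{m-1}\binom{m-1+k}{k}x^k$, and normalized so that $H_m(0)=1$. The orthogonal scaling function $\varphi_m^D$ is defined by $\widehat{\varphi_m^D}(\omega)=\frac{1}{\sqrt{2\pi}}\prod_{\ell=1}^\infty H_m(2^{-\ell}\omega)$, and the Daubechies orthonormal wavelet $\psi_m^D$ of order $m$ is defined by $\widehat{\psi_m^D}(\omega)=e^{-i\omega/2}\,\overline{H_m\left(\frac{\omega}{2}+\pi\right)}\,\widehat{\varphi_m^D}\left(\frac{\omega}{2}\right)$. *)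

theory Defs
  imports "HOL-Analysis.Analysis"
begin

definition fourier :: "(real \<Rightarrow> complex) \<Rightarrow> real \<Rightarrow> complex" where
  "fourier f \<omega> = complex_of_real (1 / sqrt (2 * pi)) * (LINT x|lborel. f x * cis (- (\<omega> * x)))"

text \<open>The coefficients of a filter of order \<open>m\<close> are \<open>h 0, \<dots>, h (2 * m - 1)\<close>;
  the values of \<open>h\<close> beyond are irrelevant.\<close>

definition filter_symbol :: "nat \<Rightarrow> (nat \<Rightarrow> real) \<Rightarrow> real \<Rightarrow> complex" where
  "filter_symbol m h \<omega> =
     complex_of_real (1 / sqrt 2) * (\<Sum>l<2*m. complex_of_real (h l) * cis (real l * \<omega>))"

text \<open>For \<open>m \<ge> 1\<close> this is the polynomial \<open>P\<close> with index \<open>m - 1\<close>.\<close>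

definition daubechies_poly :: "nat \<Rightarrow> real \<Rightarrow> real" where
  "daubechies_poly m x = (\<Sum>k<m. real ((m - 1 + k) choose k) * x ^ k)"

text \<open>The conditions determine only the modulus of the symbol; every real spectral factor,
  hence every choice of the Daubechies filter of order \<open>m\<close>, is admitted.\<close>

definition daubechies_filter :: "nat \<Rightarrow> (nat \<Rightarrow> real) \<Rightarrow> bool" where
  "daubechies_filter m h \<longleftrightarrow>
     (\<forall>\<omega>. (cmod (filter_symbol m h \<omega>))\<^sup>2
            = ((cos (\<omega> / 2))\<^sup>2) ^ m * daubechies_poly m ((sin (\<omega> / 2))\<^sup>2)) \<and>
     filter_symbol m h 0 = 1"

text \<open>Scaling function and wavelet are given by their Fourier transforms, so each is determined
  up to a null set. Both are compactly supported and square integrable, hence integrable, and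
  their transforms are given pointwise by the Fourier integral.\<close>

definition daubechies_scaling :: "nat \<Rightarrow> (nat \<Rightarrow> real) \<Rightarrow> (real \<Rightarrow> complex) \<Rightarrow> bool" where
  "daubechies_scaling m h \<phi> \<longleftrightarrow>
     integrable lborel \<phi> \<and>
     (\<forall>\<omega>. fourier \<phi> \<omega> =
            complex_of_real (1 / sqrt (2 * pi)) * prodinf (\<lambda>l. filter_symbol m h (\<omega> / 2 ^ Suc l)))"

definition daubechies_wavelet :: "nat \<Rightarrow> (real \<Rightarrow> complex) \<Rightarrow> bool" where
  "daubechies_wavelet m \<psi> \<longleftrightarrow>
     (\<exists>h \<phi>. daubechies_filter m h \<and> daubechies_scaling m h \<phi> \<and>
       integrable lborel \<psi> \<and>
       (\<forall>\<omega>. fourier \<psi> \<omega> =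
              cis (- (\<omega> / 2)) * cnj (filter_symbol m h (\<omega> / 2 + pi)) * fourier \<phi> (\<omega> / 2)))"

end

theory Submission
  imports Defs "HOL-Probability.Sinc_Integral"
begin

text \<open>
  The identity \<open>(1 - x) ^ m * P x + x ^ m * P (1 - x) = 1\<close> for the Daubechies polynomial bounds the
  symbol by \<open>1\<close>, hence the transform of the wavelet by \<open>1 / sqrt (2 * pi)\<close>; this is used for
  \<open>\<bar>\<omega>\<bar> > pi\<close>. For \<open>\<bar>\<omega>\<bar> \<le> pi\<close> the bound \<open>P \<le> 4 ^ (m - 1)\<close> leaves an integral dominated by that of
  \<open>(sin (\<omega> / 4) / \<omega>) ^ n\<close> over the whole line, and repeated integration by parts reduces the latter
  to the Dirichlet integral, which produces the alternating sum.

  The lower estimate has exponential slack. On \<open>1 \<le> \<omega> \<le> 2\<close> the integrand is at least a constant times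
  \<open>(5 / 12) ^ n / m powr (p / 2)\<close>, because the top coefficient of \<open>P\<close> gives
  \<open>\<bar>H (\<omega> / 2 + pi)\<bar>\<^sup>2 \<ge> (sin (\<omega> / 2)) ^ (2 * m) / (50 * m)\<close> and \<open>sin (\<omega> / 2) \<ge> 5 * \<omega> / 12\<close>.
  The target is of order \<open>4 ^ m / 12 ^ n\<close> up to powers of \<open>m\<close>, and \<open>4 < 5 powr p\<close>; so \<open>\<delta>\<close> may be taken as
  \<open>1\<close> for finitely many \<open>m\<close> and \<open>0\<close> afterwards.
\<close>

section \<open>The integral of an even power of the cardinal sine\<close>

text \<open>The \<open>j\<close>-th derivative of \<open>sin x ^ (2 * q)\<close>, read off its expansion into cosines; the phase
  \<open>j * pi / 2\<close> encodes the \<open>j\<close> differentiations.\<close>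

definition sine_power_deriv :: "nat \<Rightarrow> nat \<Rightarrow> real \<Rightarrow> real" where
  "sine_power_deriv q j x =
     (\<Sum>i\<le>2*q. (- 1) ^ (q + i) * real ((2*q) choose i) / 4 ^ q * (2 * real q - 2 * real i) ^ j
        * cos ((2 * real q - 2 * real i) * x + real j * pi / 2))"

text \<open>Binomial expansion of \<open>2 * \<i> * sin x = cis x - cis (- x)\<close>, followed by
  taking real parts.\<close>

lemma sin_even_power: "sin x ^ (2 * q) = sine_power_deriv q 0 x"
proof -
  have two_i_sin: "2 * \<i> * complex_of_real (sin x) = - cis (- x) + cis x"
    by (simp add: complex_eq_iff)
  have "(2 * \<i> * complex_of_real (sin x)) ^ (2*q)
        = (\<Sum>k\<le>2*q. of_nat ((2*q) choose k) * (- cis (- x)) ^ k * cis x ^ (2*q - k))"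
    unfolding two_i_sin by (rule binomial_ring)
  also have "\<dots> = (\<Sum>k\<le>2*q. complex_of_real ((- 1) ^ k * real ((2*q) choose k))
                      * cis ((2 * real q - 2 * real k) * x))"
  proof (intro sum.cong refl)
    fix k assume "k \<in> {..2*q}"
    then have angle: "real k * - x + real (2*q - k) * x = (2 * real q - 2 * real k) * x"
      by (simp add: of_nat_diff algebra_simps)
    have "(- cis (- x)) ^ k * cis x ^ (2*q - k) = (- 1) ^ k * cis ((2 * real q - 2 * real k) * x)"
      unfolding power_minus[of "cis (- x)"] Complex.DeMoivre mult.assoc cis_mult angle ..
    then show "of_nat ((2*q) choose k) * (- cis (- x)) ^ k * cis x ^ (2*q - k)
        = complex_of_real ((- 1) ^ k * real ((2*q) choose k)) * cis ((2 * real q - 2 * real k) * x)"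
      by (simp add: mult.assoc mult.left_commute)
  qed
  finally have binom: "(2 * \<i> * complex_of_real (sin x)) ^ (2*q) =
     (\<Sum>k\<le>2*q. complex_of_real ((- 1) ^ k * real ((2*q) choose k))
                      * cis ((2 * real q - 2 * real k) * x))" .
  have "(2 * \<i> * complex_of_real (sin x)) ^ (2*q) = complex_of_real ((- 4) ^ q * sin x ^ (2*q))"
    by (simp add: power_mult_distrib power_mult)
       (simp add: power_mult_distrib[symmetric])
  then have "(- 4) ^ q * sin x ^ (2*q)
      = (\<Sum>k\<le>2*q. (- 1) ^ k * real ((2*q) choose k) * cos ((2 * real q - 2 * real k) * x))"
    using arg_cong[OF binom, of Re] by simp
  \<comment> \<open>The factor \<open>(- 1) ^ q\<close> clears the sign of \<open>(- 4) ^ q\<close>;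
    this explains the exponent \<open>q + i\<close> in the definition.\<close>
  moreover have "(- 1) ^ q * (- 4) ^ q = (4::real) ^ q"
    by (simp add: power_mult_distrib[symmetric])
  ultimately have "4 ^ q * sin x ^ (2*q)
      = (- 1) ^ q * (\<Sum>k\<le>2*q. (- 1) ^ k * real ((2*q) choose k) * cos ((2 * real q - 2 * real k) * x))"
    by (metis mult.assoc)
  also have "\<dots> = 4 ^ q * sine_power_deriv q 0 x"
    by (simp add: sine_power_deriv_def sum_distrib_left power_add mult.assoc)
  finally show ?thesis by simp
qed

lemma sine_power_deriv_has_deriv:
  "(sine_power_deriv q j has_real_derivative sine_power_deriv q (Suc j) x) (at x)"
proof -
  have shift: "cos (a + real (Suc j) * pi / 2) = - sin (a + real j * pi / 2)" for a
    by (simp add: add_divide_distrib algebra_simps minus_sin_cos_eq)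
  show ?thesis
    unfolding sine_power_deriv_def[abs_def] shift
    by (auto intro!: derivative_eq_intros sum.cong)
qed

text \<open>A class of continuous functions closed under products and differentiation, so that the
  cofactors of the powers of \<open>sin\<close> below stay in it at every differentiation.\<close>

inductive trig_poly :: "(real \<Rightarrow> real) \<Rightarrow> bool" where
  trig_poly_const: "trig_poly (\<lambda>x. c)"
| trig_poly_sin: "trig_poly sin"
| trig_poly_cos: "trig_poly cos"
| trig_poly_add: "trig_poly f \<Longrightarrow> trig_poly g \<Longrightarrow> trig_poly (\<lambda>x. f x + g x)"
| trig_poly_mult: "trig_poly f \<Longrightarrow> trig_poly g \<Longrightarrow> trig_poly (\<lambda>x. f x * g x)"

lemma trig_poly_deriv:
  "trig_poly f \<Longrightarrow> \<exists>f'. trig_poly f' \<and> (\<forall>x. (f has_real_derivative f' x) (at x))"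
proof (induction rule: trig_poly.induct)
  case (trig_poly_const c)
  show ?case by (intro exI[of _ "\<lambda>x. 0"]) (auto intro: trig_poly.intros)
next
  case trig_poly_sin
  show ?case by (intro exI[of _ cos]) (auto intro: trig_poly.intros DERIV_sin)
next
  case trig_poly_cos
  show ?case
  proof (intro exI conjI allI)
    show "trig_poly (\<lambda>x. (- 1) * sin x)" by (intro trig_poly.intros)
    show "(cos has_real_derivative (- 1) * sin x) (at x)" for x
      by (rule DERIV_cong[OF DERIV_cos]) simp
  qed
next
  case (trig_poly_add f g)
  then obtain f' g' where "trig_poly f'" "\<forall>x. (f has_real_derivative f' x) (at x)"
    "trig_poly g'" "\<forall>x. (g has_real_derivative g' x) (at x)" by blast
  then show ?case
    by (intro exI[of _ "\<lambda>x. f' x + g' x"]) (auto intro!: trig_poly.intros DERIV_add)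
next
  case (trig_poly_mult f g)
  then obtain f' g' where "trig_poly f'" "\<forall>x. (f has_real_derivative f' x) (at x)"
    "trig_poly g'" "\<forall>x. (g has_real_derivative g' x) (at x)" by blast
  with trig_poly_mult show ?case
    by (intro exI[of _ "\<lambda>x. f' x * g x + g' x * f x"]) (auto intro!: trig_poly.intros DERIV_mult)
qed

text \<open>Makes the boundary terms of the repeated integration by parts vanish at \<open>0\<close>.\<close>

lemma sine_power_deriv_factor:
  assumes "j \<le> 2 * q"
  shows "\<exists>g. trig_poly g \<and> (\<forall>x. sine_power_deriv q j x = sin x ^ (2 * q - j) * g x)"
  using assms
proof (induction j)
  case 0
  show ?case
    by (intro exI[of _ "\<lambda>x. 1"]) (auto intro: trig_poly.intros simp: sin_even_power)
next
  case (Suc j)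
  define k where "k = 2 * q - Suc j"
  have k: "2 * q - j = Suc k" using Suc.prems by (simp add: k_def)
  obtain g where g: "trig_poly g" "\<And>x. sine_power_deriv q j x = sin x ^ Suc k * g x"
    using Suc k by auto
  obtain g' where g': "trig_poly g'" "\<And>x. (g has_real_derivative g' x) (at x)"
    using trig_poly_deriv[OF g(1)] by blast
  \<comment> \<open>The product rule costs one factor \<open>sin x\<close>; uniqueness of
    derivatives identifies the result with the next \<open>sine_power_deriv\<close>.\<close>
  have "sine_power_deriv q (Suc j) x = sin x ^ k * (real (Suc k) * (cos x * g x) + sin x * g' x)" for x
  proof -
    have "((\<lambda>x. sin x ^ Suc k * g x) has_real_derivative
            sin x ^ k * (real (Suc k) * (cos x * g x) + sin x * g' x)) (at x)"
      using DERIV_mult[OF DERIV_power_Suc[OF DERIV_sin] g'(2)] by (rule DERIV_cong) (simp add: algebra_simps)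
    moreover have "sine_power_deriv q j = (\<lambda>x. sin x ^ Suc k * g x)"
      using g(2) by auto
    ultimately show ?thesis
      using sine_power_deriv_has_deriv[of q j x] by (auto dest: DERIV_unique)
  qed
  moreover have "trig_poly (\<lambda>x. real (Suc k) * (cos x * g x) + sin x * g' x)"
    by (rule trig_poly.intros g g')+
  ultimately show ?case
    unfolding k_def[symmetric]
    by (intro exI[of _ "\<lambda>x. real (Suc k) * (cos x * g x) + sin x * g' x"] conjI allI)
qed

lemma trig_poly_isCont: "trig_poly f \<Longrightarrow> isCont f x"
  using trig_poly_deriv[of f] by (auto dest: DERIV_isCont)

text \<open>The numerator contains the factor \<open>sin x\<close> one time more than the
  denominator contains \<open>x\<close>, and this surplus factor forces the limit
  \<open>0\<close>.\<close>

lemma sine_power_deriv_div_tendsto_0: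
  assumes "j < 2 * q"
  shows "((\<lambda>x. sine_power_deriv q j x / x ^ (2 * q - 1 - j)) \<longlongrightarrow> 0) (at 0)"
proof -
  obtain g where g: "trig_poly g" "\<And>x. sine_power_deriv q j x = sin x ^ (2 * q - j) * g x"
    using sine_power_deriv_factor[of j q] assms by auto
  define k where "k = 2 * q - 1 - j"
  have k: "2 * q - j = Suc k" using assms by (simp add: k_def)
  have "((\<lambda>x. (sin x / x) ^ k * (sin x * g x)) \<longlongrightarrow> 1 ^ k * (sin 0 * g 0)) (at 0)"
    using trig_poly_isCont[OF g(1), of 0]
    by (intro tendsto_intros sinc_at_0) (auto simp: isCont_def)
  then show ?thesis
    unfolding g(2) k k_def[symmetric] by (simp add: power_divide mult_ac)
qed

lemma sine_power_deriv_bounded: "\<exists>B. \<forall>x. \<bar>sine_power_deriv q j x\<bar> \<le> B"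
proof (intro exI allI)
  fix x
  show "\<bar>sine_power_deriv q j x\<bar> \<le>
    (\<Sum>i\<le>2*q. \<bar>(- 1) ^ (q + i) * real ((2*q) choose i) / 4 ^ q * (2 * real q - 2 * real i) ^ j\<bar>)"
    unfolding sine_power_deriv_def
    by (rule order_trans[OF sum_abs], rule sum_mono, subst abs_mult)
       (intro mult_left_le abs_cos_le_one abs_ge_zero)
qed

text \<open>At this order the phase is \<open>q * pi - pi / 2\<close>, so cosines turn into sines,
  as \<open>Si\<close> requires, and the resulting sign \<open>(- 1) ^ q\<close> reduces
  \<open>(- 1) ^ (q + i)\<close> to \<open>(- 1) ^ i\<close>.\<close>

lemma sine_power_deriv_odd:
  assumes "0 < q"
  shows "sine_power_deriv q (2 * q - 1) x =
    (\<Sum>i\<le>2*q. (- 1) ^ i * real ((2*q) choose i) / 4 ^ q * (2 * real q - 2 * real i) ^ (2*q - 1)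
        * sin ((2 * real q - 2 * real i) * x))"
proof -
  have "cos (y + real (2 * q - 1) * pi / 2) = (- 1) ^ q * sin y" for y
  proof -
    have "y + real (2 * q - 1) * pi / 2 = (y - pi / 2) + real q * pi"
      using assms by (simp add: of_nat_diff field_simps)
    then show ?thesis
      by (simp only: cos_add sin_npi cos_npi) (simp add: cos_diff)
  qed
  moreover have "(- 1) ^ (q + i) * a * b * ((- 1) ^ q * c) = (- 1) ^ i * a * b * (c::real)" for i a b c
    by (simp add: power_add)
  ultimately show ?thesis
    by (simp add: sine_power_deriv_def) (intro sum.cong refl, simp add: power_add)
qed

section \<open>The sine integral and the primitive of an even power of the cardinal sine\<close>

lemma Si_odd: "Si (- x) = - Si x"
  using Si_neg[of x] Si_neg[of "- x"] by (cases "x \<ge> 0") auto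

lemma Si_0: "Si 0 = 0"
  using Si_odd[of 0] by simp

text \<open>Oddness of \<open>Si\<close> carries the limit from positive to negative
  \<open>a\<close>. The value \<open>a = 0\<close> occurs as well, as the frequency of index
  \<open>i = q\<close>.\<close>

lemma Si_scaled_at_top: "((\<lambda>x. Si (a * x)) \<longlongrightarrow> sgn a * (pi / 2)) at_top"
proof -
  have pos: "((\<lambda>x. Si (b * x)) \<longlongrightarrow> pi / 2) at_top" if "b > 0" for b
    by (rule filterlim_compose[OF Si_at_top])
       (auto intro: filterlim_tendsto_pos_mult_at_top that filterlim_ident tendsto_const)
  consider "a > 0" | "a = 0" | "a < 0" by linarith
  then show ?thesis
  proof cases
    case 3
    then show ?thesis
      using tendsto_minus[OF pos[of "- a"]] by (simp add: Si_odd)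
  qed (use pos in \<open>auto simp: Si_0\<close>)
qed

text \<open>The result of integrating \<open>(sin x / x) ^ (2 * q)\<close> by parts \<open>2 * q - 1\<close> times.\<close>

definition sinc_power_primitive :: "nat \<Rightarrow> real \<Rightarrow> real" where
  "sinc_power_primitive q x =
     (\<Sum>i\<le>2*q. (- 1) ^ i * real ((2*q) choose i) / 4 ^ q * (2 * real q - 2 * real i) ^ (2*q - 1)
         * Si ((2 * real q - 2 * real i) * x)) / fact (2*q - 1)
     - (\<Sum>j<2*q - 1. fact (2*q - 2 - j) / fact (2*q - 1) * (sine_power_deriv q j x / x ^ (2*q - 1 - j)))"

lemma sinc_power_primitive_has_deriv:
  assumes "0 < q" "0 < x"
  shows "(sinc_power_primitive q has_real_derivative (sin x / x) ^ (2 * q)) (at x)"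
proof -
  define N where "N = 2 * q - 1"
  have N: "2 * q = Suc N" using assms by (simp add: N_def)
  \<comment> \<open>Up to boundary terms, \<open>t j\<close> is the integrand after \<open>j\<close>
    integrations by parts. The boundary sum has derivative \<open>t N - t 0\<close> by telescoping
    and the \<open>Si\<close> part has derivative \<open>t N\<close>, so their difference leaves
    \<open>t 0\<close>, the original integrand.\<close>
  define t where "t j = fact (N - j) / fact N * (sine_power_deriv q j x / x ^ (Suc N - j))" for j
  have sum_part: "((\<lambda>x. \<Sum>j<N. fact (N - 1 - j) / fact N * (sine_power_deriv q j x / x ^ (N - j)))
       has_real_derivative (\<Sum>j<N. t (Suc j) - t j)) (at x)"
  proof (rule DERIV_sum)
    fix j assume "j \<in> {..<N}"
    define k where "k = N - 1 - j"
    have k: "N - j = Suc k" "Suc N - j = Suc (Suc k)" "N - 1 - j = k" "N - Suc j = k"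
      using \<open>j \<in> {..<N}\<close> by (auto simp: k_def)
    show "((\<lambda>x. fact (N - 1 - j) / fact N * (sine_power_deriv q j x / x ^ (N - j)))
       has_real_derivative t (Suc j) - t j) (at x)"
      unfolding t_def k diff_Suc_Suc
    proof (rule DERIV_cong[OF DERIV_cmult[OF DERIV_divide[OF sine_power_deriv_has_deriv DERIV_pow]]])
      show "fact k / fact N * ((sine_power_deriv q (Suc j) x * x ^ Suc k
            - sine_power_deriv q j x * (real (Suc k) * x ^ (Suc k - Suc 0))) / (x ^ Suc k * x ^ Suc k))
          = fact k / fact N * (sine_power_deriv q (Suc j) x / x ^ Suc k)
            - fact (Suc k) / fact N * (sine_power_deriv q j x / x ^ Suc (Suc k))"
        using assms by (simp add: field_simps)
    qed (use assms in auto)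
  qed
  have Si_part: "((\<lambda>x. (\<Sum>i\<le>2*q. (- 1) ^ i * real ((2*q) choose i) / 4 ^ q
         * (2 * real q - 2 * real i) ^ N * Si ((2 * real q - 2 * real i) * x)) / fact N)
       has_real_derivative t N) (at x)"
  proof -
    have Si_deriv: "((\<lambda>x. Si (a * x)) has_real_derivative sin (a * x) / x) (at x)" for a
      using assms
      using assms
      by (intro DERIV_cong[OF DERIV_chain2[OF DERIV_Si DERIV_cmult[OF DERIV_ident]]]) (simp add: Si_0)
    have "t N = sine_power_deriv q (2 * q - 1) x / x / fact N"
      using assms by (simp add: t_def N_def)
    also have "\<dots> = (\<Sum>i\<le>2*q. (- 1) ^ i * real ((2*q) choose i) / 4 ^ q
         * (2 * real q - 2 * real i) ^ N * (sin ((2 * real q - 2 * real i) * x) / x)) / fact N"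
      unfolding sine_power_deriv_odd[OF assms(1)] by (simp add: N_def sum_divide_distrib)
    finally show ?thesis
      by (simp only:) (intro DERIV_cdivide DERIV_sum DERIV_cmult Si_deriv)
  qed
  have "(sinc_power_primitive q has_real_derivative t N - (\<Sum>j<N. t (Suc j) - t j)) (at x)"
    using DERIV_diff[OF Si_part sum_part]
    by (simp add: sinc_power_primitive_def[abs_def] N_def)
  also have "t N - (\<Sum>j<N. t (Suc j) - t j) = (sin x / x) ^ (2 * q)"
    unfolding sum_lessThan_telescope
    by (simp add: t_def sin_even_power[symmetric] power_divide flip: N)
  finally show ?thesis .
qed

lemma sinc_power_primitive_at_right_0:
  assumes "0 < q"
  shows "(sinc_power_primitive q \<longlongrightarrow> 0) (at_right 0)"
proof -
  have Si_lim: "((\<lambda>x. Si (a * x)) \<longlongrightarrow> 0) (at_right 0)" for a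
  proof -
    have "isCont (\<lambda>x. Si (a * x)) 0"
      by (rule isCont_o2[OF _ isCont_Si]) auto
    then show ?thesis
      by (auto simp: isCont_def Si_0 intro: tendsto_within_subset)
  qed
  have "(sinc_power_primitive q \<longlongrightarrow>
     (\<Sum>i\<le>2*q. (- 1) ^ i * real ((2*q) choose i) / 4 ^ q * (2 * real q - 2 * real i) ^ (2*q - 1)
         * 0) / fact (2*q - 1)
     - (\<Sum>j<2*q - 1. fact (2*q - 2 - j) / fact (2*q - 1) * 0)) (at_right 0)"
    unfolding sinc_power_primitive_def[abs_def]
    by (intro tendsto_diff tendsto_divide tendsto_sum tendsto_mult tendsto_const Si_lim
          tendsto_within_subset[OF sine_power_deriv_div_tendsto_0]) auto
  then show ?thesis by simp
qed

text \<open>The boundary terms are bounded functions over positive powers of \<open>x\<close> and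
  die out; only the \<open>Si\<close> terms survive.\<close>

lemma sinc_power_primitive_at_top:
  assumes "0 < q"
  shows "(sinc_power_primitive q \<longlongrightarrow>
     (\<Sum>i\<le>2*q. (- 1) ^ i * real ((2*q) choose i) / 4 ^ q * (2 * real q - 2 * real i) ^ (2*q - 1)
         * (sgn (2 * real q - 2 * real i) * (pi / 2))) / fact (2*q - 1)) at_top"
proof -
  have decay: "((\<lambda>x. sine_power_deriv q j x / x ^ (2*q - 1 - j)) \<longlongrightarrow> 0) at_top"
    if "j < 2*q - 1" for j
  proof -
    obtain B where B: "\<And>x. \<bar>sine_power_deriv q j x\<bar> \<le> B"
      using sine_power_deriv_bounded by blast
    have "filterlim (\<lambda>x::real. x ^ (2*q - 1 - j)) at_top at_top"
      by (intro filterlim_pow_at_top filterlim_ident) (use that in auto)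
    then have lim: "((\<lambda>x::real. B / x ^ (2*q - 1 - j)) \<longlongrightarrow> 0) at_top"
      by (intro tendsto_divide_0[OF tendsto_const] filterlim_at_top_imp_at_infinity)
    show ?thesis
      by (rule Lim_null_comparison[OF _ lim], rule eventually_mono[OF eventually_gt_at_top[of 0]])
         (auto simp: B abs_mult intro!: divide_right_mono)
  qed
  have "(sinc_power_primitive q \<longlongrightarrow>
     (\<Sum>i\<le>2*q. (- 1) ^ i * real ((2*q) choose i) / 4 ^ q * (2 * real q - 2 * real i) ^ (2*q - 1)
         * (sgn (2 * real q - 2 * real i) * (pi / 2))) / fact (2*q - 1)
     - (\<Sum>j<2*q - 1. fact (2*q - 2 - j) / fact (2*q - 1) * 0)) at_top"
    unfolding sinc_power_primitive_def[abs_def]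
    by (intro tendsto_diff tendsto_divide tendsto_sum tendsto_mult tendsto_const Si_scaled_at_top decay)
       auto
  then show ?thesis by simp
qed

text \<open>The reflection \<open>i \<mapsto> 2 * q - i\<close> flips the sign of both the odd power
  and \<open>sgn\<close>, so the two halves of the sum agree. This truncates the sum at
  \<open>q\<close>, which is \<open>n div 2\<close> in the theorem.\<close>

lemma alternating_sgn_sum:
  assumes "0 < q"
  shows "(\<Sum>i\<le>2*q. (- 1) ^ i * real ((2*q) choose i) * (2 * real q - 2 * real i) ^ (2*q - 1)
         * sgn (2 * real q - 2 * real i))
     = 2 * (\<Sum>i\<le>q. (- 1) ^ i * real ((2*q) choose i) * (2 * real q - 2 * real i) ^ (2*q - 1))"
    (is "sum ?f _ = 2 * sum ?g _")
proof -
  have "{..2*q} = {..<q} \<union> {q} \<union> {q<..2*q}" by auto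
  then have "sum ?f {..2*q} = sum ?f {..<q} + ?f q + sum ?f {q<..2*q}"
    using sum.union_disjoint[of "{..<q} \<union> {q}" "{q<..2*q}" ?f] sum.union_disjoint[of "{..<q}" "{q}" ?f]
    by (simp only: sum.insert finite.intros) force
  also have "sum ?f {q<..2*q} = sum ?f {..<q}"
  proof (rule sum.reindex_bij_witness[of _ "\<lambda>i. 2*q - i" "\<lambda>i. 2*q - i"])
    fix i assume i: "i \<in> {q<..2*q}"
    have "(2 * real q - 2 * real (2 * q - i)) = - (2 * real q - 2 * real i)"
      using i by (simp add: of_nat_diff)
    moreover have "(- 1 :: real) ^ (2 * q - i) = (- 1) ^ i" 
      using i by (simp add: minus_one_power_iff)
    moreover have "(2 * q) choose (2 * q - i) = (2 * q) choose i"
      using i by (intro binomial_symmetric[symmetric]) auto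
    moreover have "(- d) ^ (2 * q - 1) * sgn (- d) = d ^ (2 * q - 1) * sgn d" for d :: real
      using assms by (simp add: sgn_minus)
    ultimately show "?f (2 * q - i) = ?f i"
      by (simp only: mult.assoc)
  qed auto
  also have "sum ?f {..<q} = sum ?g {..<q}"
    by (intro sum.cong refl) simp
  also have "?f q = 0" by simp
  finally have "sum ?f {..2*q} = 2 * sum ?g {..<q}" by simp
  \<comment> \<open>The term \<open>i = q\<close> contains \<open>0 ^ (2 * q - 1)\<close>, whose
    exponent is positive, so it may be included.\<close>
  also have "sum ?g {..<q} = sum ?g {..q}"
    using assms by (simp add: lessThan_Suc_atMost[symmetric])
  finally show ?thesis .
qed

text \<open>The positive half line contributes the limit of the primitive at infinity, since its
  limit at the origin is \<open>0\<close>; evenness of the integrand doubles this.\<close>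

lemma has_bochner_integral_sinc_power:
  assumes "0 < q"
  shows "has_bochner_integral lborel (\<lambda>x. (sin x / x) ^ (2 * q))
     (pi * 2 / 4 ^ q / fact (2*q - 1) *
       (\<Sum>i\<le>q. (- 1) ^ i * real ((2*q) choose i) * (2 * real q - 2 * real i) ^ (2*q - 1)))"
    (is "has_bochner_integral _ _ ?I")
proof -
  let ?L = "(\<Sum>i\<le>2*q. (- 1) ^ i * real ((2*q) choose i) / 4 ^ q * (2 * real q - 2 * real i) ^ (2*q - 1)
         * (sgn (2 * real q - 2 * real i) * (pi / 2))) / fact (2*q - 1)"
  have L: "?L = ?I / 2"
  proof -
    have "?L = pi / 2 / 4 ^ q / fact (2*q - 1) *
       (\<Sum>i\<le>2*q. (- 1) ^ i * real ((2*q) choose i) * (2 * real q - 2 * real i) ^ (2*q - 1)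
         * sgn (2 * real q - 2 * real i))"
      by (simp add: sum_distrib_left sum_divide_distrib mult_ac)
    then show ?thesis
      unfolding alternating_sgn_sum[OF assms] by simp
  qed
  have FTC: "set_integrable lborel (einterval 0 \<infinity>) (\<lambda>x. (sin x / x) ^ (2 * q))"
    "(LBINT x=0..\<infinity>. (sin x / x) ^ (2 * q)) = ?L - 0"
  proof -
    have lims: "((sinc_power_primitive q \<circ> real_of_ereal) \<longlongrightarrow> 0) (at_right 0)"
      "((sinc_power_primitive q \<circ> real_of_ereal) \<longlongrightarrow> ?L) (at_left \<infinity>)"
      using sinc_power_primitive_at_right_0[OF assms] sinc_power_primitive_at_top[OF assms]
      by (simp_all add: zero_ereal_def ereal_tendsto_simps)
    have zero_less_infinity: "(0 :: ereal) < \<infinity>" by simp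
    have deriv: "(sinc_power_primitive q has_real_derivative (sin x / x) ^ (2 * q)) (at x)"
      if "0 < ereal x" "ereal x < \<infinity>" for x
      using that assms by (intro sinc_power_primitive_has_deriv) auto
    have cont: "isCont (\<lambda>x. (sin x / x) ^ (2 * q)) x"
      if "0 < ereal x" "ereal x < \<infinity>" for x :: real
      using that by (intro continuous_intros) auto
    have nonneg: "AE x in lborel. 0 < ereal x \<longrightarrow> ereal x < \<infinity> \<longrightarrow> 0 \<le> (sin x / x) ^ (2 * q)"
      by simp
    show "set_integrable lborel (einterval 0 \<infinity>) (\<lambda>x. (sin x / x) ^ (2 * q))"
      "(LBINT x=0..\<infinity>. (sin x / x) ^ (2 * q)) = ?L - 0"
      by (rule interval_integral_FTC_nonneg[OF zero_less_infinity deriv cont nonneg lims]; assumption)+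
  qed
  \<comment> \<open>The rule for even functions wants the closed half line; the added endpoint is a
    null set.\<close>
  have AE: "AE x in lborel. indicator (einterval 0 \<infinity>) x *\<^sub>R (sin x / x) ^ (2 * q)
       = indicator {0..} x *\<^sub>R (sin x / x) ^ (2 * q)"
    using AE_lborel_singleton[of "0::real"]
    by eventually_elim (auto simp: einterval_def indicator_def zero_ereal_def)
  have "has_bochner_integral lborel (\<lambda>x. indicator (einterval 0 \<infinity>) x *\<^sub>R (sin x / x) ^ (2 * q)) (?I / 2)"
    using FTC unfolding L
    by (simp add: has_bochner_integral_iff set_integrable_def set_lebesgue_integral_def
          interval_lebesgue_integral_def)
  then have "has_bochner_integral lborel (\<lambda>x. indicator {0..} x *\<^sub>R (sin x / x) ^ (2 * q)) (?I / 2)"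
    by (subst (asm) has_bochner_integral_cong_AE[OF _ _ AE]) auto
  then have "has_bochner_integral lborel (\<lambda>x. (sin x / x) ^ (2 * q)) (2 *\<^sub>R (?I / 2))"
    by (rule has_bochner_integral_even_function) simp
  then show ?thesis unfolding real_scaleR_def by (simp only: mult_2 field_sum_of_halves)
qed

section \<open>The Daubechies polynomial and the filter symbol\<close>

text \<open>Pascal's rule: multiplication by \<open>1 - x\<close> lowers \<open>Suc r\<close> to
  \<open>r\<close> and leaves a single term beyond the truncation.\<close>

lemma one_minus_times_binomial_sum:
  fixes x :: real
  shows "(1 - x) * (\<Sum>i\<le>n. real ((Suc r + i) choose i) * x ^ i)
    = (\<Sum>i\<le>n. real ((r + i) choose i) * x ^ i) - real ((Suc r + n) choose n) * x ^ Suc n"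
proof (induction n)
  case (Suc n)
  have "real ((Suc r + Suc n) choose Suc n) = real ((r + Suc n) choose Suc n) + real ((Suc r + n) choose n)"
    by simp
  with Suc show ?case
    by (simp add: algebra_simps del: binomial_Suc_Suc)
qed simp

lemma daubechies_poly_Suc: "daubechies_poly (Suc k) x = (\<Sum>i\<le>k. real ((k + i) choose i) * x ^ i)"
  by (simp add: daubechies_poly_def lessThan_Suc_atMost)

text \<open>Since \<open>(2 * k + 2) choose (k + 1)\<close> is twice
  \<open>(2 * k + 1) choose (k + 1)\<close>, the correction acquires the factor
  \<open>1 - 2 * x\<close>, which is odd under \<open>x \<mapsto> 1 - x\<close>.\<close>

lemma one_minus_times_daubechies_poly:
  "(1 - x) * daubechies_poly (Suc (Suc k)) x
     = daubechies_poly (Suc k) x + real ((2 * k + 1) choose Suc k) * x ^ Suc k * (1 - 2 * x)"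
proof -
  have "(2 * k + 1) choose k = (2 * k + 1) choose Suc k"
    by (subst binomial_symmetric) auto
  moreover have "Suc k + Suc k = Suc (2 * k + 1)" by simp
  ultimately have central: "real ((Suc k + Suc k) choose Suc k) = 2 * real ((2 * k + 1) choose Suc k)"
    by (simp only: binomial_Suc_Suc)
  have odd: "k + Suc k = 2 * k + 1" by simp
  have "(1 - x) * daubechies_poly (Suc (Suc k)) x
     = daubechies_poly (Suc k) x + real ((k + Suc k) choose Suc k) * x ^ Suc k
       - real ((Suc k + Suc k) choose Suc k) * x ^ Suc (Suc k)"
    unfolding daubechies_poly_Suc one_minus_times_binomial_sum by simp
  also have "\<dots> = daubechies_poly (Suc k) x + real ((2 * k + 1) choose Suc k) * x ^ Suc k * (1 - 2 * x)"
    unfolding central odd by (simp add: algebra_simps del: binomial_Suc_Suc)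
  finally show ?thesis .
qed

text \<open>With \<open>x = (sin (\<omega> / 2))\<^sup>2\<close> this is the quadrature mirror
  condition: the squared moduli of the symbol at \<open>\<omega>\<close> and
  \<open>\<omega> + pi\<close> add up to \<open>1\<close>.\<close>

lemma daubechies_poly_bezout:
  assumes "1 \<le> m"
  shows "(1 - x) ^ m * daubechies_poly m x + x ^ m * daubechies_poly m (1 - x) = 1"
  using assms
proof (induction m rule: dec_induct)
  case base
  show ?case by (simp add: daubechies_poly_def)
next
  case (step m)
  obtain k where m: "m = Suc k" using step(1) by (cases m) auto
  define c where "c = real ((2 * k + 1) choose Suc k)"
  have "(1 - x) ^ Suc m * daubechies_poly (Suc m) x + x ^ Suc m * daubechies_poly (Suc m) (1 - x)
      = (1 - x) ^ m * ((1 - x) * daubechies_poly (Suc m) x)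
        + x ^ m * ((1 - (1 - x)) * daubechies_poly (Suc m) (1 - x))"
    by simp
  also have "\<dots> = (1 - x) ^ m * (daubechies_poly m x + c * x ^ m * (1 - 2 * x))
        + x ^ m * (daubechies_poly m (1 - x) + c * (1 - x) ^ m * (1 - 2 * (1 - x)))"
    unfolding m one_minus_times_daubechies_poly c_def ..
  \<comment> \<open>The two corrections are opposite because
    \<open>1 - 2 * (1 - x) = - (1 - 2 * x)\<close>.\<close>
  also have "\<dots> = (1 - x) ^ m * daubechies_poly m x + x ^ m * daubechies_poly m (1 - x)"
    by (simp add: algebra_simps)
  finally show ?case using step by simp
qed

lemma daubechies_poly_nonneg: "0 \<le> x \<Longrightarrow> 0 \<le> daubechies_poly m x"
  by (auto simp: daubechies_poly_def intro!: sum_nonneg)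

text \<open>The coefficients are nonnegative, so the value at \<open>1\<close> dominates. It equals
  \<open>(2 * k + 1) choose k\<close>, a single entry of the half row of binomial coefficients with
  sum \<open>4 ^ k\<close>.\<close>

lemma daubechies_poly_le:
  assumes "0 \<le> x" "x \<le> 1"
  shows "daubechies_poly (Suc k) x \<le> 4 ^ k"
proof -
  have "daubechies_poly (Suc k) x \<le> (\<Sum>i\<le>k. real ((k + i) choose i))"
    unfolding daubechies_poly_Suc using assms
    by (intro sum_mono) (auto intro: mult_left_le power_le_one)
  also have "\<dots> = real ((2 * k + 1) choose k)"
    unfolding of_nat_sum[symmetric] sum_choose_lower mult_2 by simp
  also have "\<dots> \<le> real (\<Sum>i\<le>k. (2 * k + 1) choose i)"
    by (intro of_nat_mono member_le_sum) auto
  also have "\<dots> = 4 ^ k"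
    unfolding binomial_r_part_sum by (simp add: power_mult)
  finally show ?thesis .
qed

text \<open>Only the top term is kept; its coefficient is the central binomial coefficient.\<close>

lemma daubechies_poly_ge:
  assumes "0 \<le> x"
  shows "4 ^ k / (2 * real (Suc k)) * x ^ k \<le> daubechies_poly (Suc k) x"
proof -
  have "4 ^ k / (2 * real (Suc k)) \<le> real ((2 * k) choose k)"
  \<comment> \<open>The central binomial bound has denominator \<open>2 * k\<close>; weakening it to
    \<open>2 * Suc k\<close> admits \<open>k = 0\<close>.\<close>
  proof (cases "k = 0")
    case False
    then have "4 ^ k / (2 * real (Suc k)) \<le> 4 ^ k / (2 * real k)"
      by (intro divide_left_mono) auto
    also have "\<dots> \<le> real ((2 * k) choose k)"
      using False by (intro central_binomial_lower_bound) auto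
    finally show ?thesis .
  qed simp
  then have "4 ^ k / (2 * real (Suc k)) * x ^ k \<le> real ((k + k) choose k) * x ^ k"
    using assms unfolding mult_2 by (intro mult_right_mono) auto
  also have "\<dots> \<le> daubechies_poly (Suc k) x"
    unfolding daubechies_poly_Suc using assms
    by (intro member_le_sum[where f = "\<lambda>i. real ((k + i) choose i) * x ^ i"]) auto
  finally show ?thesis .
qed

section \<open>Pointwise estimates of the filter symbol\<close>

lemma filter_symbol_sq:
  assumes "daubechies_filter m h"
  shows "(cmod (filter_symbol m h \<omega>))\<^sup>2
     = (1 - (sin (\<omega> / 2))\<^sup>2) ^ m * daubechies_poly m ((sin (\<omega> / 2))\<^sup>2)"
  using assms by (simp add: daubechies_filter_def cos_squared_eq)

lemma filter_symbol_sq_shift: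
  assumes "daubechies_filter m h"
  shows "(cmod (filter_symbol m h (\<omega> + pi)))\<^sup>2
     = ((sin (\<omega> / 2))\<^sup>2) ^ m * daubechies_poly m (1 - (sin (\<omega> / 2))\<^sup>2)"
proof -
  have "sin ((\<omega> + pi) / 2) = cos (\<omega> / 2)"
    by (simp add: add_divide_distrib sin_add)
  then show ?thesis
    using filter_symbol_sq[OF assms, of "\<omega> + pi"] by (simp add: cos_squared_eq)
qed

lemma sin_sq_le_1: "(sin x)\<^sup>2 \<le> (1::real)"
  by (simp add: abs_square_le_1)

lemma filter_symbol_le_1:
  assumes "daubechies_filter m h" "1 \<le> m"
  shows "cmod (filter_symbol m h \<omega>) \<le> 1"
proof -
  define x where "x = (sin (\<omega> / 2))\<^sup>2"
  have x: "0 \<le> x" "x \<le> 1" by (auto simp: x_def sin_sq_le_1)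
  have "(cmod (filter_symbol m h \<omega>))\<^sup>2 = 1 - x ^ m * daubechies_poly m (1 - x)"
    using filter_symbol_sq[OF assms(1)] daubechies_poly_bezout[OF assms(2), of x]
    by (simp add: x_def)
  also have "\<dots> \<le> 1"
    using x daubechies_poly_nonneg[of "1 - x" m] by simp
  finally show ?thesis
    by (simp add: abs_square_le_1)
qed

text \<open>The polynomial is at most \<open>4 ^ k\<close> on the unit interval, and the square root
  of that is the factor \<open>2 ^ k\<close>.\<close>

lemma filter_symbol_shift_le:
  assumes "daubechies_filter (Suc k) h"
  shows "cmod (filter_symbol (Suc k) h (\<omega> + pi)) \<le> \<bar>sin (\<omega> / 2)\<bar> ^ Suc k * 2 ^ k"
proof (rule power2_le_imp_le)
  define s where "s = (sin (\<omega> / 2))\<^sup>2"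
  have s: "0 \<le> s" "s \<le> 1" by (auto simp: s_def sin_sq_le_1)
  have "(cmod (filter_symbol (Suc k) h (\<omega> + pi)))\<^sup>2 = s ^ Suc k * daubechies_poly (Suc k) (1 - s)"
    using filter_symbol_sq_shift[OF assms] by (simp add: s_def)
  also have "\<dots> \<le> s ^ Suc k * 4 ^ k"
    using s by (intro mult_left_mono daubechies_poly_le) auto
  also have "\<dots> = (\<bar>sin (\<omega> / 2)\<bar> ^ Suc k * 2 ^ k)\<^sup>2"
  proof -
    have "(4::real) ^ k = (2 ^ k)\<^sup>2"
      by (simp add: power2_eq_square power_mult_distrib[symmetric])
    moreover have "s ^ Suc k = (\<bar>sin (\<omega> / 2)\<bar> ^ Suc k)\<^sup>2"
      unfolding s_def by (metis power2_abs power_mult mult.commute)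
    ultimately show ?thesis by (simp only: power_mult_distrib)
  qed
  finally show "(cmod (filter_symbol (Suc k) h (\<omega> + pi)))\<^sup>2 \<le> \<dots>" .
qed simp

lemma filter_symbol_shift_ge:
  assumes "daubechies_filter m h" "1 \<le> m" "1 \<le> \<omega>" "\<omega> \<le> 2"
  shows "(5 * \<omega> / 12) ^ (2 * m) / (50 * real m) \<le> (cmod (filter_symbol m h (\<omega> / 2 + pi)))\<^sup>2"
proof -
  obtain k where m: "m = Suc k" using assms(2) by (cases m) auto
  define s where "s = (sin (\<omega> / 4))\<^sup>2"
  have s: "0 \<le> s" "s \<le> 1" by (auto simp: s_def sin_sq_le_1)
  \<comment> \<open>The cubic term is \<open>\<omega> ^ 3 / 48 \<le> \<omega> / 12\<close> for
    \<open>\<omega> \<le> 2\<close>, and \<open>1 / 2 - 1 / 12 = 5 / 12\<close>.\<close>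
  have "\<omega> / 2 - (\<omega> / 2) ^ 3 / 6 \<le> sin (\<omega> / 2)"
  proof -
    have "\<bar>sin (\<omega> / 2) - \<omega> / 2\<bar> \<le> (\<omega> / 2) ^ 3 / 6"
      using Maclaurin_sin_bound[of "\<omega> / 2" 3] assms
      by (simp add: numeral_eq_Suc sin_coeff_def fact_numeral)
    then show ?thesis by linarith
  qed
  moreover have "\<omega> ^ 3 \<le> 4 * \<omega>"
    using assms mult_mono[of \<omega> 2 \<omega> 2] by (simp add: power3_eq_cube)
  ultimately have sin_ge: "5 * \<omega> / 12 \<le> sin (\<omega> / 2)"
    by (simp add: power_divide)
  have sin_sq: "(sin (\<omega> / 2))\<^sup>2 = 4 * (s * (1 - s))"
    using sin_double[of "\<omega> / 4"] by (simp add: s_def power_mult_distrib sin_cos_squared_add cos_squared_eq)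
  have sin_sq_ge: "(5 * \<omega> / 12)\<^sup>2 \<le> (sin (\<omega> / 2))\<^sup>2"
    using assms sin_ge by (intro power_mono) auto
  have "(5 / 12)\<^sup>2 \<le> (5 * \<omega> / 12)\<^sup>2"
    using assms by (intro power_mono) auto
  also note sin_sq_ge
  also have "(sin (\<omega> / 2))\<^sup>2 \<le> 4 * s"
    using s by (simp add: sin_sq mult_left_le)
  \<comment> \<open>Here \<open>(5 / 12)\<^sup>2 / 4 = 25 / 576\<close>, which exceeds
    \<open>1 / 25\<close>.\<close>
  finally have s_ge: "1 / 25 \<le> s" by (simp add: power2_eq_square)
  have "(5 * \<omega> / 12) ^ (2 * m) / (50 * real m) \<le> ((sin (\<omega> / 2))\<^sup>2) ^ m / (50 * real m)"
    using sin_sq_ge by (intro divide_right_mono) (auto simp: power_mult intro: power_mono)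
  \<comment> \<open>Only \<open>k = m - 1\<close> factors \<open>4 * (s * (1 - s))\<close> can be
    formed from \<open>s ^ m * (4 * (1 - s)) ^ k\<close>. The remaining \<open>s\<close> is at least
    \<open>1 / 25\<close>, whence \<open>50 = 25 * 2\<close>.\<close>
  also have "\<dots> \<le> ((sin (\<omega> / 2))\<^sup>2) ^ k / (50 * real m)"
    by (intro divide_right_mono power_decreasing) (auto simp: m sin_sq_le_1)
  also have "\<dots> = (1 / 25) * (((sin (\<omega> / 2))\<^sup>2) ^ k / (2 * real m))" by simp
  also have "\<dots> \<le> s * (((sin (\<omega> / 2))\<^sup>2) ^ k / (2 * real m))"
    using s_ge by (intro mult_right_mono) auto
  also have "\<dots> = s ^ m * (4 ^ k / (2 * real m) * (1 - s) ^ k)"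
    by (simp add: sin_sq power_mult_distrib m)
  also have "\<dots> \<le> s ^ m * daubechies_poly m (1 - s)"
    using s unfolding m by (intro mult_left_mono daubechies_poly_ge) auto
  also have "\<dots> = (cmod (filter_symbol m h (\<omega> / 2 + pi)))\<^sup>2"
    using filter_symbol_sq_shift[OF assms(1), of "\<omega> / 2"] by (simp add: s_def)
  finally show ?thesis .
qed

text \<open>The defect from \<open>1\<close> is at most \<open>s * (4 * s) ^ k\<close>, and
  \<open>\<bar>y\<bar> \<le> 1\<close> makes \<open>4 * s \<le> 1\<close>. The bound is uniform in
  \<open>m\<close>, so the product of dilates can be bounded below uniformly too.\<close>

lemma filter_symbol_low_frequency:
  assumes "daubechies_filter m h" "1 \<le> m" "\<bar>y\<bar> \<le> 1"
  shows "1 - (y / 2)\<^sup>2 \<le> (cmod (filter_symbol m h y))\<^sup>2"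
proof -
  obtain k where m: "m = Suc k" using assms(2) by (cases m) auto
  define s where "s = (sin (y / 2))\<^sup>2"
  have s: "0 \<le> s" "s \<le> 1" by (auto simp: s_def sin_sq_le_1)
  have s_le: "s \<le> (y / 2)\<^sup>2"
    unfolding s_def by (rule abs_le_square_iff[THEN iffD1]) (use abs_sin_x_le_abs_x[of "y / 2"] in auto)
  also have "(y / 2)\<^sup>2 \<le> 1 / 4"
    using assms(3) by (simp add: power_divide abs_square_le_1)
  finally have s4: "4 * s \<le> 1" by simp
  have "s ^ m * daubechies_poly m (1 - s) \<le> s ^ m * 4 ^ k"
    unfolding m using s by (intro mult_left_mono daubechies_poly_le) auto
  also have "\<dots> = s * (4 * s) ^ k"
    by (simp add: m power_mult_distrib)
  also have "\<dots> \<le> s"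
    using s s4 by (intro mult_left_le power_le_one) auto
  finally have "s ^ m * daubechies_poly m (1 - s) \<le> (y / 2)\<^sup>2" using s_le by simp
  then show ?thesis
    using filter_symbol_sq[OF assms(1), of y] daubechies_poly_bezout[OF assms(2), of s]
    by (simp add: s_def)
qed

section \<open>Convergence and size of the infinite product\<close>

lemma continuous_filter_symbol: "continuous_on UNIV (filter_symbol m h)"
  unfolding filter_symbol_def[abs_def] by (intro continuous_intros)

text \<open>From \<open>cmod (cis t - 1) = 2 * \<bar>sin (t / 2)\<bar> \<le> \<bar>t\<bar>\<close>.
  The constant may depend on the filter, as it serves convergence only.\<close>

lemma filter_symbol_lipschitz:
  "\<exists>C. \<forall>y. cmod (filter_symbol m h y - filter_symbol m h 0) \<le> C * \<bar>y\<bar>"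
proof (intro exI allI)
  fix y
  have cis_le: "cmod (cis t - 1) \<le> \<bar>t\<bar>" for t
    using dist_exp_i_1[of t] abs_sin_x_le_abs_x[of "t / 2"] by (simp add: cis_conv_exp mult.commute)
  have "filter_symbol m h y - filter_symbol m h 0
     = complex_of_real (1 / sqrt 2) * (\<Sum>l<2*m. complex_of_real (h l) * (cis (real l * y) - 1))"
    by (simp add: filter_symbol_def algebra_simps sum_subtractf sum_distrib_left)
  also have "cmod \<dots> = 1 / sqrt 2 * cmod (\<Sum>l<2*m. complex_of_real (h l) * (cis (real l * y) - 1))"
    by (simp add: norm_mult norm_divide)
  also have "\<dots> \<le> 1 / sqrt 2 * (\<Sum>l<2*m. \<bar>h l\<bar> * \<bar>real l * y\<bar>)"
    by (intro mult_left_mono sum_norm_le) (auto simp: norm_mult simp del: abs_mult intro!: mult_left_mono cis_le)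
  also have "\<dots> = (1 / sqrt 2 * (\<Sum>l<2*m. \<bar>h l\<bar> * real l)) * \<bar>y\<bar>"
    by (simp add: sum_distrib_right sum_distrib_left abs_mult mult.assoc)
  finally show "cmod (filter_symbol m h y - filter_symbol m h 0) \<le> \<dots>" .
qed

text \<open>By the Lipschitz bound the factors differ from \<open>1\<close> by a geometric sequence,
  so the product converges absolutely and \<open>prodinf\<close> is the limit of its partial
  products.\<close>

lemma scaling_product_LIMSEQ:
  assumes "daubechies_filter m h"
  shows "(\<lambda>n. \<Prod>i\<le>n. filter_symbol m h (\<omega> / 2 ^ Suc i))
           \<longlonglongrightarrow> prodinf (\<lambda>l. filter_symbol m h (\<omega> / 2 ^ Suc l))"
proof -
  have h0: "filter_symbol m h 0 = 1" using assms by (simp add: daubechies_filter_def)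
  obtain C where C: "\<And>y. cmod (filter_symbol m h y - 1) \<le> C * \<bar>y\<bar>"
    using filter_symbol_lipschitz[of m h] unfolding h0 by blast
  have "summable (\<lambda>l. C * \<bar>\<omega>\<bar> / 2 * (1 / 2) ^ l)"
    by (intro summable_mult summable_geometric) auto
  then have "summable (\<lambda>l. norm (filter_symbol m h (\<omega> / 2 ^ Suc l) - 1))"
  proof (rule summable_comparison_test'[where N = 0])
    fix l :: nat
    show "norm (norm (filter_symbol m h (\<omega> / 2 ^ Suc l) - 1)) \<le> C * \<bar>\<omega>\<bar> / 2 * (1 / 2) ^ l"
      using C[of "\<omega> / 2 ^ Suc l"] by (simp add: power_divide)
  qed
  then show ?thesis
    by (intro convergent_prod_LIMSEQ abs_convergent_prod_imp_convergent_prod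
          summable_imp_abs_convergent_prod)
qed

lemma scaling_product_le_1:
  assumes "daubechies_filter m h" "1 \<le> m"
  shows "cmod (prodinf (\<lambda>l. filter_symbol m h (\<omega> / 2 ^ Suc l))) \<le> 1"
proof (rule LIMSEQ_le_const2[OF tendsto_norm[OF scaling_product_LIMSEQ[OF assms(1)]]])
  have "cmod (\<Prod>i\<le>n. filter_symbol m h (\<omega> / 2 ^ Suc i)) \<le> 1" for n
    unfolding prod_norm[symmetric]
    by (intro prod_le_1) (use filter_symbol_le_1[OF assms] in auto)
  then show "\<exists>N. \<forall>n\<ge>N. cmod (\<Prod>i\<le>n. filter_symbol m h (\<omega> / 2 ^ Suc i)) \<le> 1"
    by blast
qed

text \<open>The Weierstrass product inequality.\<close>

lemma one_minus_sum_le_prod: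
  fixes a :: "nat \<Rightarrow> real"
  assumes "\<And>i. 0 \<le> a i" "\<And>i. a i \<le> 1"
  shows "1 - (\<Sum>i\<le>n. a i) \<le> (\<Prod>i\<le>n. 1 - a i)"
proof (induction n)
  case (Suc n)
  have "a (Suc n) * (\<Prod>i\<le>n. 1 - a i) \<le> a (Suc n)"
    using assms by (intro mult_left_le prod_le_1) auto
  with Suc show ?case by (simp add: algebra_simps)
qed simp

text \<open>By the low-frequency estimate the squared factors are at least \<open>1 - a i\<close>,
  where the \<open>a i\<close> decay like \<open>4\<close> to the power \<open>- i\<close> and have
  a small sum.\<close>

lemma scaling_product_ge:
  assumes "daubechies_filter m h" "1 \<le> m" "\<bar>\<omega>\<bar> \<le> 1"
  shows "1 / 2 \<le> (cmod (prodinf (\<lambda>l. filter_symbol m h (\<omega> / 2 ^ Suc l))))\<^sup>2"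
proof (rule LIMSEQ_le_const[OF tendsto_power[OF tendsto_norm[OF scaling_product_LIMSEQ[OF assms(1)]]]])
  have "1 / 2 \<le> (cmod (\<Prod>i\<le>n. filter_symbol m h (\<omega> / 2 ^ Suc i)))\<^sup>2" for n
  proof -
    define a where "a i = (\<omega> / 2 ^ Suc i / 2)\<^sup>2" for i :: nat
    have y_le: "\<bar>\<omega> / 2 ^ Suc i\<bar> \<le> 1 / 2 ^ Suc i" for i :: nat
      using assms(3) by (simp add: divide_right_mono)
    have y_le_1: "\<bar>\<omega> / 2 ^ Suc i\<bar> \<le> 1" for i :: nat
      by (rule order_trans[OF y_le]) (simp add: divide_simps, metis one_le_numeral one_le_power power_Suc)
    have a_le: "a i \<le> (1 / 16) * (1 / 4) ^ i" for i
    proof -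
      have "a i = \<bar>\<omega> / 2 ^ Suc i\<bar>\<^sup>2 / 4" by (simp add: a_def power_divide)
      also have "\<dots> \<le> (1 / 2 ^ Suc i)\<^sup>2 / 4"
        by (intro divide_right_mono power_mono y_le) auto
      also have "\<dots> = (1 / 16) * (1 / 4) ^ i"
        by (simp add: power2_eq_square power_divide power_mult_distrib[symmetric])
      finally show ?thesis .
    qed
    have a_le_1: "a i \<le> 1" for i
    proof -
      have "(1 / 4 :: real) ^ i \<le> 1" by (simp add: power_le_one)
      with a_le[of i] show ?thesis by linarith
    qed
    have "(\<Sum>i\<le>n. a i) \<le> (\<Sum>i\<le>n. (1 / 16) * (1 / 4) ^ i)"
      by (intro sum_mono a_le)
    \<comment> \<open>The full geometric series has the sum
      \<open>(1 / 16) * (4 / 3)\<close>.\<close>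
    also have "\<dots> \<le> 1 / 12"
      unfolding sum_distrib_left[symmetric]
      using sum_gp_basic[of "1 / 4 :: real" n] zero_le_power[of "1 / 4 :: real" "Suc n", simplified]
      by simp
    finally have "1 / 2 \<le> 1 - (\<Sum>i\<le>n. a i)" by simp
    also have "\<dots> \<le> (\<Prod>i\<le>n. 1 - a i)"
    proof (rule one_minus_sum_le_prod)
      show "a i \<le> 1" for i
        by (rule a_le_1)
    qed (simp add: a_def)
    also have "\<dots> \<le> (\<Prod>i\<le>n. (cmod (filter_symbol m h (\<omega> / 2 ^ Suc i)))\<^sup>2)"
    proof (rule prod_mono, intro conjI)
      fix i assume "i \<in> {..n}"
      show "0 \<le> 1 - a i"
        using a_le_1[of i] by simp
      show "1 - a i \<le> (cmod (filter_symbol m h (\<omega> / 2 ^ Suc i)))\<^sup>2"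
        unfolding a_def by (rule filter_symbol_low_frequency[OF assms(1,2) y_le_1])
    qed
    finally show ?thesis
      by (simp add: prod_norm[symmetric] prod_power_distrib)
  qed
  then show "\<exists>N. \<forall>n\<ge>N. 1 / 2 \<le> (cmod (\<Prod>i\<le>n. filter_symbol m h (\<omega> / 2 ^ Suc i)))\<^sup>2"
    by blast
qed

section \<open>Modulus of the transform of the wavelet\<close>

lemma daubechies_wavelet_norm:
  assumes "daubechies_wavelet m \<psi>"
  obtains h where "daubechies_filter m h"
    "\<And>\<omega>. cmod (fourier \<psi> \<omega>) = cmod (filter_symbol m h (\<omega> / 2 + pi))
       * cmod (prodinf (\<lambda>l. filter_symbol m h (\<omega> / 2 / 2 ^ Suc l))) / sqrt (2 * pi)"
proof -
  obtain h \<phi> where h: "daubechies_filter m h" "daubechies_scaling m h \<phi>"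
    "\<And>\<omega>. fourier \<psi> \<omega> =
       cis (- (\<omega> / 2)) * cnj (filter_symbol m h (\<omega> / 2 + pi)) * fourier \<phi> (\<omega> / 2)"
    using assms unfolding daubechies_wavelet_def by blast
  show ?thesis
  proof (rule that[OF h(1)])
    show "cmod (fourier \<psi> \<omega>) = cmod (filter_symbol m h (\<omega> / 2 + pi))
       * cmod (prodinf (\<lambda>l. filter_symbol m h (\<omega> / 2 / 2 ^ Suc l))) / sqrt (2 * pi)" for \<omega>
      using h(2) unfolding h(3) daubechies_scaling_def
      by (simp add: norm_mult norm_divide)
  qed
qed

text \<open>The infinite product is a pointwise limit of continuous partial products.\<close>

lemma daubechies_wavelet_measurable:
  assumes "daubechies_wavelet m \<psi>"
  shows "(\<lambda>\<omega>. cmod (fourier \<psi> \<omega>)) \<in> borel_measurable borel"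
proof -
  obtain h where h: "daubechies_filter m h"
    "\<And>\<omega>. cmod (fourier \<psi> \<omega>) = cmod (filter_symbol m h (\<omega> / 2 + pi))
       * cmod (prodinf (\<lambda>l. filter_symbol m h (\<omega> / 2 / 2 ^ Suc l))) / sqrt (2 * pi)"
    using daubechies_wavelet_norm[OF assms] by blast
  have [measurable]: "filter_symbol m h \<in> borel_measurable borel"
    by (intro borel_measurable_continuous_onI continuous_filter_symbol)
  have [measurable]: "(\<lambda>\<omega>. prodinf (\<lambda>l. filter_symbol m h (\<omega> / 2 / 2 ^ Suc l))) \<in> borel_measurable borel"
    by (rule borel_measurable_LIMSEQ_metric[OF _ scaling_product_LIMSEQ[OF h(1)]]) measurable
  show ?thesis unfolding h(2) by measurable
qed

section \<open>Bounds for the weighted integral\<close>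

text \<open>Substitution of \<open>x / 4\<close>: the Jacobian gives \<open>4\<close>, and turning
  \<open>x / 4\<close> in the denominator into \<open>x\<close> gives
  \<open>(1 / 16) ^ q\<close>.\<close>

lemma has_bochner_integral_sinc_power_scaled:
  assumes "0 < q"
  shows "has_bochner_integral lborel (\<lambda>x. (sin (x / 4) / x) ^ (2 * q))
     (8 * pi / 64 ^ q / fact (2*q - 1) *
       (\<Sum>i\<le>q. (- 1) ^ i * real ((2*q) choose i) * (2 * real q - 2 * real i) ^ (2*q - 1)))"
    (is "has_bochner_integral _ _ (_ / _ / _ * ?S)")
proof -
  have "has_bochner_integral lborel (\<lambda>x. (sin (0 + 1 / 4 * x) / (0 + 1 / 4 * x)) ^ (2 * q))
      ((pi * 2 / 4 ^ q / fact (2*q - 1) * ?S) /\<^sub>R \<bar>1 / 4\<bar>)"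
    using has_bochner_integral_sinc_power[OF assms]
    by (subst lborel_has_bochner_integral_real_affine_iff[symmetric]) auto
  then have "has_bochner_integral lborel
      (\<lambda>x. (1 / 16) ^ q * (sin (0 + 1 / 4 * x) / (0 + 1 / 4 * x)) ^ (2 * q))
      ((1 / 16) ^ q * ((pi * 2 / 4 ^ q / fact (2*q - 1) * ?S) /\<^sub>R \<bar>1 / 4\<bar>))"
    by (rule has_bochner_integral_mult_right)
  also have "(\<lambda>x::real. (1 / 16) ^ q * (sin (0 + 1 / 4 * x) / (0 + 1 / 4 * x)) ^ (2 * q))
      = (\<lambda>x. (sin (x / 4) / x) ^ (2 * q))"
  proof
    fix x :: real
    have "(1 / 16) ^ q = (1 / 4 :: real) ^ (2 * q)"
      by (simp add: power_mult power2_eq_square)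
    then show "(1 / 16) ^ q * (sin (0 + 1 / 4 * x) / (0 + 1 / 4 * x)) ^ (2 * q) = (sin (x / 4) / x) ^ (2 * q)"
      by (simp only: power_mult_distrib[symmetric]) simp
  qed
  also have "(1 / 16) ^ q * ((pi * 2 / 4 ^ q / fact (2*q - 1) * ?S) /\<^sub>R \<bar>1 / 4\<bar>)
      = 8 * pi / 64 ^ q / fact (2*q - 1) * ?S"
  proof -
    have "(64::real) ^ q = 16 ^ q * 4 ^ q" by (simp add: power_mult_distrib[symmetric])
    then show ?thesis by (simp add: power_divide)
  qed
  finally show ?thesis .
qed

lemma has_bochner_integral_powr_tails:
  fixes a c :: real
  assumes "1 < a" "0 < c"
  shows "has_bochner_integral lborel (\<lambda>x. indicator {x. c < \<bar>x\<bar>} x * \<bar>x\<bar> powr (- a))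
     (2 * (c powr (1 - a) / (a - 1)))"
proof -
  define F where "F x = - (x powr (1 - a) / (a - 1))" for x :: real
  have deriv: "(F has_real_derivative x powr (- a)) (at x)" if "ereal c < ereal x" "ereal x < \<infinity>" for x
    unfolding F_def[abs_def]
  proof (rule DERIV_cong[OF DERIV_minus[OF DERIV_cdivide[OF has_real_derivative_powr]]])
    show "0 < x" using that assms by simp
    have "- ((1 - a) * P / (a - 1)) = P" for P
      using assms by (simp add: field_simps)
    then show "- ((1 - a) * x powr (1 - a - 1) / (a - 1)) = x powr (- a)" by simp
  qed
  have "(F \<longlongrightarrow> F c) (at_right c)"
    unfolding F_def using assms by (intro tendsto_intros) auto
  then have c_lim: "((F \<circ> real_of_ereal) \<longlongrightarrow> F c) (at_right (ereal c))"
    by (simp add: ereal_tendsto_simps)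
  have "(F \<longlongrightarrow> - (0 / (a - 1))) at_top"
    unfolding F_def using assms
    by (intro tendsto_intros tendsto_neg_powr filterlim_ident) auto
  then have top_lim: "((F \<circ> real_of_ereal) \<longlongrightarrow> 0) (at_left \<infinity>)"
    by (simp add: ereal_tendsto_simps)
  have cont: "isCont (\<lambda>x. x powr (- a)) x" if "ereal c < ereal x" "ereal x < \<infinity>" for x
    using that assms by (intro continuous_intros) auto
  have nonneg: "AE x in lborel. ereal c < ereal x \<longrightarrow> ereal x < \<infinity> \<longrightarrow> 0 \<le> x powr (- a)"
    by simp
  have c_less: "ereal c < \<infinity>" by simp
  note FTC = interval_integral_FTC_nonneg[OF c_less deriv cont nonneg c_lim top_lim]
  have "has_bochner_integral lborel (\<lambda>x. indicator (einterval c \<infinity>) x *\<^sub>R x powr (- a)) (0 - F c)"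
    using FTC by (simp add: has_bochner_integral_iff set_integrable_def set_lebesgue_integral_def
          interval_lebesgue_integral_def)
  also have "(\<lambda>x. indicator (einterval c \<infinity>) x *\<^sub>R x powr (- a))
      = (\<lambda>x. indicator {0..} x *\<^sub>R (indicator {x. c < \<bar>x\<bar>} x * \<bar>x\<bar> powr (- a)))"
    using assms(2) by (auto simp: einterval_def indicator_def fun_eq_iff)
  finally have "has_bochner_integral lborel (\<lambda>x. indicator {x. c < \<bar>x\<bar>} x * \<bar>x\<bar> powr (- a)) (2 *\<^sub>R (0 - F c))"
    by (rule has_bochner_integral_even_function) (auto simp: indicator_def)
  then show ?thesis by (simp add: F_def)
qed

text \<open>The product has modulus at most \<open>1\<close>, so both bounds come from the symbol at
  \<open>\<omega> / 2 + pi\<close>; its shift estimate halves \<open>\<omega> / 2\<close>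
  again.\<close>

lemma daubechies_wavelet_le:
  assumes "daubechies_wavelet m \<psi>" "1 \<le> m"
  shows "cmod (fourier \<psi> \<omega>) \<le> 1 / sqrt (2 * pi)"
    and "cmod (fourier \<psi> \<omega>) \<le> \<bar>sin (\<omega> / 4)\<bar> ^ m * 2 ^ (m - 1) / sqrt (2 * pi)"
proof -
  obtain h where h: "daubechies_filter m h"
    "\<And>\<omega>. cmod (fourier \<psi> \<omega>) = cmod (filter_symbol m h (\<omega> / 2 + pi))
       * cmod (prodinf (\<lambda>l. filter_symbol m h (\<omega> / 2 / 2 ^ Suc l))) / sqrt (2 * pi)"
    using daubechies_wavelet_norm[OF assms(1)] by blast
  have "cmod (fourier \<psi> \<omega>) \<le> cmod (filter_symbol m h (\<omega> / 2 + pi)) / sqrt (2 * pi)"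
    unfolding h(2) using scaling_product_le_1[OF h(1) assms(2), of "\<omega> / 2"]
    by (intro divide_right_mono mult_left_le) auto
  moreover have "cmod (filter_symbol m h (\<omega> / 2 + pi)) / sqrt (2 * pi) \<le> 1 / sqrt (2 * pi)"
    by (intro divide_right_mono filter_symbol_le_1[OF h(1) assms(2)]) auto
  moreover have "cmod (filter_symbol m h (\<omega> / 2 + pi)) / sqrt (2 * pi)
      \<le> \<bar>sin (\<omega> / 4)\<bar> ^ m * 2 ^ (m - 1) / sqrt (2 * pi)"
    using filter_symbol_shift_le[of "m - 1" h "\<omega> / 2"] h(1) assms(2)
    by (intro divide_right_mono) auto
  ultimately show "cmod (fourier \<psi> \<omega>) \<le> 1 / sqrt (2 * pi)"
    "cmod (fourier \<psi> \<omega>) \<le> \<bar>sin (\<omega> / 4)\<bar> ^ m * 2 ^ (m - 1) / sqrt (2 * pi)"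
    by linarith+
qed

lemma daubechies_wavelet_ge:
  assumes "daubechies_wavelet m \<psi>" "1 \<le> m" "1 \<le> \<omega>" "\<omega> \<le> 2"
  shows "(5 * \<omega> / 12) ^ m / sqrt (200 * pi * real m) \<le> cmod (fourier \<psi> \<omega>)"
proof (rule power2_le_imp_le)
  obtain h where h: "daubechies_filter m h"
    "\<And>\<omega>. cmod (fourier \<psi> \<omega>) = cmod (filter_symbol m h (\<omega> / 2 + pi))
       * cmod (prodinf (\<lambda>l. filter_symbol m h (\<omega> / 2 / 2 ^ Suc l))) / sqrt (2 * pi)"
    using daubechies_wavelet_norm[OF assms(1)] by blast
  \<comment> \<open>Here \<open>200 * pi\<close> collects \<open>50\<close> from the symbol,
    \<open>2\<close> from the lower bound of the product at \<open>\<omega> / 2 \<le> 1\<close>, and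
    \<open>2 * pi\<close> from the normalization.\<close>
  have "((5 * \<omega> / 12) ^ m / sqrt (200 * pi * real m))\<^sup>2
      = (5 * \<omega> / 12) ^ (2 * m) / (50 * real m) * (1 / 2) / (2 * pi)"
    unfolding power_divide[of "(5 * \<omega> / 12) ^ m" "sqrt (200 * pi * real m)"] power_mult[symmetric]
      mult.commute[of m 2] by simp
  also have "\<dots> \<le> (cmod (filter_symbol m h (\<omega> / 2 + pi)))\<^sup>2
       * (cmod (prodinf (\<lambda>l. filter_symbol m h (\<omega> / 2 / 2 ^ Suc l))))\<^sup>2 / (2 * pi)"
    using assms
    by (intro divide_right_mono mult_mono filter_symbol_shift_ge[OF h(1)] scaling_product_ge[OF h(1)]) auto
  also have "\<dots> = (cmod (fourier \<psi> \<omega>))\<^sup>2"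
    by (simp add: h(2) power_divide power_mult_distrib)
  finally show "((5 * \<omega> / 12) ^ m / sqrt (200 * pi * real m))\<^sup>2 \<le> (cmod (fourier \<psi> \<omega>))\<^sup>2" .
qed simp

text \<open>One summand suffices on each side of \<open>\<bar>\<omega>\<bar> = pi\<close>; the other
  one is nonnegative there.\<close>

lemma weighted_wavelet_le:
  assumes "daubechies_wavelet m \<psi>" "1 \<le> m" "1 < p" "real (2 * q) = real m * p"
  shows "\<bar>\<omega>\<bar> powr (- (real m * p)) * cmod (fourier \<psi> \<omega>) powr p
    \<le> (2 * pi) powr (- p / 2) * 2 powr (real (m - 1) * p) * (sin (\<omega> / 4) / \<omega>) ^ (2 * q)
      + (2 * pi) powr (- p / 2) * (indicator {x. pi < \<bar>x\<bar>} \<omega> * \<bar>\<omega>\<bar> powr (- (real m * p)))"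
proof -
  have sqrt_powr: "(1 / sqrt (2 * pi)) powr p = (2 * pi) powr (- p / 2)"
    by (simp add: powr_divide powr_half_sqrt[symmetric] powr_powr powr_minus_divide)
  \<comment> \<open>A nonzero exponent lets \<open>powr\<close> agree with the natural power even at
    base \<open>0\<close>.\<close>
  have q: "2 * q \<noteq> 0"
  proof
    assume "2 * q = 0"
    then have "real m * p = 0" using assms(4) by simp
    with assms(2,3) show False by simp
  qed
  have sinc_nonneg: "0 \<le> (sin (\<omega> / 4) / \<omega>) ^ (2 * q)" by simp
  show ?thesis
  proof (cases "pi < \<bar>\<omega>\<bar>")
    case True
    have "cmod (fourier \<psi> \<omega>) powr p \<le> (1 / sqrt (2 * pi)) powr p"
      using assms by (intro powr_mono2 daubechies_wavelet_le) auto
    then have "\<bar>\<omega>\<bar> powr (- (real m * p)) * cmod (fourier \<psi> \<omega>) powr p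
        \<le> \<bar>\<omega>\<bar> powr (- (real m * p)) * (2 * pi) powr (- p / 2)"
      unfolding sqrt_powr by (intro mult_left_mono) auto
    moreover have "0 \<le> (2 * pi) powr (- p / 2) * 2 powr (real (m - 1) * p) * (sin (\<omega> / 4) / \<omega>) ^ (2 * q)"
      using sinc_nonneg by (intro mult_nonneg_nonneg) auto
    ultimately show ?thesis using True by (simp add: mult.commute)
  next
    case near: False
    show ?thesis
    \<comment> \<open>At the origin the left-hand side is \<open>0\<close>, because
      \<open>0 powr a = 0\<close>.\<close>
    proof (cases "\<omega> = 0")
      case True
      then show ?thesis using sinc_nonneg by simp
    next
      case False
      define s where "s = \<bar>sin (\<omega> / 4)\<bar>"
      have s_powr: "\<bar>\<omega>\<bar> powr (- (real m * p)) * s powr (real m * p) = (sin (\<omega> / 4) / \<omega>) ^ (2 * q)"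
      proof -
        have "\<bar>\<omega>\<bar> powr (- (real m * p)) * s powr (real m * p) = (s / \<bar>\<omega>\<bar>) powr (real m * p)"
          by (simp add: powr_minus_divide powr_divide s_def)
        also have "\<dots> = \<bar>sin (\<omega> / 4) / \<omega>\<bar> ^ (2 * q)"
          unfolding assms(4)[symmetric] s_def abs_divide[symmetric]
          using q by (intro powr_realpow') auto
        also have "\<dots> = (sin (\<omega> / 4) / \<omega>) ^ (2 * q)" by (rule power_even_abs) simp
        finally show ?thesis .
      qed
      have "cmod (fourier \<psi> \<omega>) powr p \<le> (s ^ m * 2 ^ (m - 1) / sqrt (2 * pi)) powr p"
        using assms unfolding s_def by (intro powr_mono2 daubechies_wavelet_le) auto
      also have "\<dots> = (s ^ m) powr p * (2 ^ (m - 1)) powr p * (1 / sqrt (2 * pi)) powr p"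
        by (simp add: powr_mult powr_divide s_def)
      also have "(2 ^ (m - 1)) powr p = 2 powr (real (m - 1) * p)"
        by (simp add: powr_realpow[symmetric] powr_powr del: of_nat_diff)
      also have "(s ^ m) powr p = s powr (real m * p)"
        using assms(2) powr_realpow'[of s m] by (simp add: s_def powr_powr[symmetric])
      finally have "\<bar>\<omega>\<bar> powr (- (real m * p)) * cmod (fourier \<psi> \<omega>) powr p \<le>
         \<bar>\<omega>\<bar> powr (- (real m * p)) * (s powr (real m * p) * 2 powr (real (m - 1) * p) * (2 * pi) powr (- p / 2))"
        unfolding sqrt_powr by (intro mult_left_mono) auto
      also have "\<dots> = (2 * pi) powr (- p / 2) * 2 powr (real (m - 1) * p)
           * (\<bar>\<omega>\<bar> powr (- (real m * p)) * s powr (real m * p))"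
        by (simp add: mult_ac)
      finally show ?thesis
        unfolding s_powr using near by simp
    qed
  qed
qed

text \<open>Integration of the pointwise majorant: the tails give the first summand exactly, the
  cardinal sine the second with some loss in the power of \<open>2\<close>.\<close>

lemma weighted_wavelet_integral:
  fixes p :: real
  assumes \<psi>: "daubechies_wavelet m \<psi>" and m: "1 \<le> m" and p: "1 < p"
    and n: "real n = real m * p" "even n"
  defines "g \<equiv> \<lambda>\<omega>. \<bar>\<omega>\<bar> powr (- (real m * p)) * cmod (fourier \<psi> \<omega>) powr p"
  shows "integrable lborel g"
    and "(LINT \<omega>|lborel. g \<omega>) \<le>
      2 powr (1 - p / 2) / (pi powr (p * (real m + 1 / 2) - 1) * (real m * p - 1))
            + 2 powr (1 - p * (2 * real m - 1)) / (pi powr (p / 2 - 1) * fact (n - 1))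
              * (\<Sum>i = 0..n div 2. (- 1) ^ i * (fact n / (fact (n - i) * fact i))
                    * (real n - 2 * real i) ^ (n - 1))"
proof -
  obtain q where q: "n = 2 * q" using n(2) by blast
  have mp: "1 < real m * p"
  proof -
    have "1 * p \<le> real m * p" using m p by (intro mult_right_mono) auto
    with p show ?thesis by linarith
  qed
  have "0 < q" using mp n(1) q by (cases q) auto
  have n': "real (2 * q) = real m * p" using n q by simp
  define S where "S = (\<Sum>i\<le>q. (- 1) ^ i * real ((2*q) choose i) * (2 * real q - 2 * real i) ^ (2*q - 1))"
  define K where "K = (2 * pi) powr (- p / 2)"
  define L where "L = K * 2 powr (real (m - 1) * p)"
  define I where "I = 8 * pi / 64 ^ q / fact (2*q - 1) * S"
  define T where "T = 2 * (pi powr (1 - real m * p) / (real m * p - 1))"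
  define b where "b = (\<lambda>\<omega>. L * (sin (\<omega> / 4) / \<omega>) ^ (2 * q)
      + K * (indicator {x. pi < \<bar>x\<bar>} \<omega> * \<bar>\<omega>\<bar> powr (- (real m * p))))"
  have sinc: "has_bochner_integral lborel (\<lambda>x. (sin (x / 4) / x) ^ (2 * q)) I"
    unfolding I_def S_def by (rule has_bochner_integral_sinc_power_scaled[OF \<open>0 < q\<close>])
  have b: "has_bochner_integral lborel b (L * I + K * T)"
    unfolding b_def T_def
    by (intro has_bochner_integral_add has_bochner_integral_mult_right sinc
          has_bochner_integral_powr_tails mp pi_gt_zero)
  have le: "g \<omega> \<le> b \<omega>" for \<omega>
    unfolding g_def b_def K_def L_def using weighted_wavelet_le[OF \<psi> m p n'] by simp
  have [measurable]: "(\<lambda>\<omega>. cmod (fourier \<psi> \<omega>)) \<in> borel_measurable borel"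
    by (rule daubechies_wavelet_measurable[OF \<psi>])
  have meas: "g \<in> borel_measurable lborel"
    unfolding g_def by measurable
  have g_nonneg: "0 \<le> g \<omega>" for \<omega> by (simp add: g_def)
  show int: "integrable lborel g"
    using b le g_nonneg
    by (intro Bochner_Integration.integrable_bound[OF _ meas, of b])
       (auto simp: has_bochner_integral_iff intro!: AE_I2 order_trans[OF le])
  have "(LINT \<omega>|lborel. g \<omega>) \<le> (LINT \<omega>|lborel. b \<omega>)"
    using b by (intro integral_mono int le) (auto simp: has_bochner_integral_iff)
  also have "\<dots> = K * T + L * I"
    using b by (simp add: has_bochner_integral_iff)
  also have "K * T = 2 powr (1 - p / 2) / (pi powr (p * (real m + 1 / 2) - 1) * (real m * p - 1))"
  proof -
    have "K * (2 * pi powr (1 - real m * p)) = 2 powr (1 - p / 2) * pi powr (- (p * (real m + 1 / 2) - 1))"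
    proof -
      have "K * (2 * pi powr (1 - real m * p)) = (2 powr 1 * 2 powr (- p / 2)) * (pi powr (- p / 2) * pi powr (1 - real m * p))"
        by (simp add: K_def powr_mult)
      also have "\<dots> = 2 powr (1 + - p / 2) * pi powr (- p / 2 + (1 - real m * p))"
        by (simp only: powr_add)
      finally show ?thesis by (simp add: algebra_simps)
    qed
    then show ?thesis
      unfolding T_def powr_minus_divide by simp
  qed
  also have "L * I \<le> 2 powr (1 - p * (2 * real m - 1)) / (pi powr (p / 2 - 1) * fact (n - 1)) * S"
  proof -
    \<comment> \<open>The sign of the alternating sum \<open>S\<close> is not visible directly; it
      is read off from the integral of a nonnegative function.\<close>
    have "0 \<le> I"
      unfolding has_bochner_integral_integral_eq[OF sinc, symmetric]
      by (intro Bochner_Integration.integral_nonneg) simp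
    moreover have "0 < 8 * pi / 64 ^ q / fact (2*q - 1)" by simp
    ultimately have S: "0 \<le> S"
      unfolding I_def by (metis not_le mult_pos_neg)
    have L8: "L * (8 * pi / 64 ^ q) = 2 powr (- p / 2 + (real m - 1) * p + 3 - 3 * (real m * p)) * pi powr (- (p / 2 - 1))"
    proof -
      have "(64::real) ^ q = 8 ^ (2 * q)" by (simp add: power_mult)
      also have "\<dots> = (2 powr 3) powr (real (2 * q))" by (subst powr_realpow) auto
      also have "\<dots> = 2 powr (3 * (real m * p))" unfolding n' powr_powr ..
      finally have e64: "(64::real) ^ q = 2 powr (3 * (real m * p))" .
      have e8: "(8::real) = 2 powr 3" by simp
      have "L * (8 * pi / 64 ^ q) = (2 powr (- p / 2) * 2 powr ((real m - 1) * p) * 2 powr 3 / 2 powr (3 * (real m * p)))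
          * (pi powr (- p / 2) * pi powr 1)"
        unfolding L_def K_def e64 using m by (simp add: powr_mult of_nat_diff)
      also have "\<dots> = 2 powr (- p / 2 + (real m - 1) * p + 3 - 3 * (real m * p)) * pi powr (- p / 2 + 1)"
        by (simp only: powr_add powr_diff)
      finally show ?thesis by simp
    qed
    have "L * I = L * (8 * pi / 64 ^ q) * (S / fact (2 * q - 1))"
      by (simp add: I_def)
    \<comment> \<open>The exponent \<open>3 - 2 * m * p - 3 * p / 2\<close> is at most
      \<open>1 - 2 * m * p + p\<close>, because \<open>2 \<le> 5 * p / 2\<close>.\<close>
    also have "\<dots> \<le> 2 powr (1 - p * (2 * real m - 1)) * pi powr (- (p / 2 - 1)) * (S / fact (2 * q - 1))"
      unfolding L8 using p S
      by (intro mult_right_mono powr_mono divide_nonneg_nonneg) (auto simp: algebra_simps)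
    also have "\<dots> = 2 powr (1 - p * (2 * real m - 1)) / (pi powr (p / 2 - 1) * fact (n - 1)) * S"
      unfolding powr_minus_divide[of pi "p / 2 - 1"] q by simp
    finally show ?thesis .
  qed
  also have "S = (\<Sum>i = 0..n div 2. (- 1) ^ i * (fact n / (fact (n - i) * fact i))
                    * (real n - 2 * real i) ^ (n - 1))"
    unfolding S_def atLeast0AtMost q
    by (intro sum.cong) (auto simp: binomial_fact mult.commute)
  finally show "(LINT \<omega>|lborel. g \<omega>) \<le>
      2 powr (1 - p / 2) / (pi powr (p * (real m + 1 / 2) - 1) * (real m * p - 1))
            + 2 powr (1 - p * (2 * real m - 1)) / (pi powr (p / 2 - 1) * fact (n - 1))
              * (\<Sum>i = 0..n div 2. (- 1) ^ i * (fact n / (fact (n - i) * fact i))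
                    * (real n - 2 * real i) ^ (n - 1))"
    by simp
qed

section \<open>The lower bound and its comparison with the target\<close>

text \<open>On \<open>{1..2}\<close> the weight cancels the power of \<open>\<omega>\<close> in the
  pointwise bound, leaving a constant on an interval of length \<open>1\<close>.\<close>

lemma weighted_wavelet_integral_ge:
  fixes p :: real
  assumes \<psi>: "daubechies_wavelet m \<psi>" and m: "1 \<le> m" and p: "1 < p"
    and int: "integrable lborel (\<lambda>\<omega>. \<bar>\<omega>\<bar> powr (- (real m * p)) * cmod (fourier \<psi> \<omega>) powr p)"
  shows "(5 / 12) powr (real m * p) * (200 * pi * real m) powr (- p / 2)
    \<le> (LINT \<omega>|lborel. \<bar>\<omega>\<bar> powr (- (real m * p)) * cmod (fourier \<psi> \<omega>) powr p)"
proof -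
  let ?c = "(5 / 12) powr (real m * p) * (200 * pi * real m) powr (- p / 2)"
  have pointwise: "?c \<le> \<bar>\<omega>\<bar> powr (- (real m * p)) * cmod (fourier \<psi> \<omega>) powr p"
    if \<omega>: "1 \<le> \<omega>" "\<omega> \<le> 2" for \<omega>
  proof -
    have pos: "0 < 5 * \<omega> / 12" using \<omega> by simp
    have "?c = \<bar>\<omega>\<bar> powr (- (real m * p)) * ((5 * \<omega> / 12) powr (real m * p) * (200 * pi * real m) powr (- p / 2))"
    proof -
      have "(5 * \<omega> / 12) powr (real m * p) = (5 / 12) powr (real m * p) * \<omega> powr (real m * p)"
        using \<omega> powr_mult[of "5 / 12" \<omega> "real m * p"] by simp
      then show ?thesis using \<omega> by (simp add: powr_minus_divide)
    qed
    also have "(5 * \<omega> / 12) powr (real m * p) * (200 * pi * real m) powr (- p / 2)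
        = ((5 * \<omega> / 12) ^ m / sqrt (200 * pi * real m)) powr p"
    proof -
      have "((5 * \<omega> / 12) ^ m) powr p = (5 * \<omega> / 12) powr (real m * p)"
        unfolding powr_realpow[OF pos, symmetric] powr_powr ..
      moreover have "(sqrt (200 * pi * real m)) powr p = (200 * pi * real m) powr (p / 2)"
        using m by (simp add: powr_half_sqrt[symmetric] powr_powr)
      ultimately show ?thesis
        using pos m by (subst powr_divide) (auto simp: powr_minus_divide)
    qed
    also have "\<bar>\<omega>\<bar> powr (- (real m * p)) * \<dots> \<le> \<bar>\<omega>\<bar> powr (- (real m * p)) * cmod (fourier \<psi> \<omega>) powr p"
      using \<omega> m p by (intro mult_left_mono powr_mono2 daubechies_wavelet_ge[OF \<psi> m]) auto
    finally show ?thesis .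
  qed
  have "?c = (LINT \<omega>|lborel. indicator {1..2::real} \<omega> * ?c)"
    by simp
  also have "\<dots> \<le> (LINT \<omega>|lborel. \<bar>\<omega>\<bar> powr (- (real m * p)) * cmod (fourier \<psi> \<omega>) powr p)"
  proof (rule integral_mono[OF _ int])
    show "integrable lborel (\<lambda>\<omega>. indicator {1..2::real} \<omega> * ?c)"
      by (intro integrable_mult_left integrable_real_indicator) auto
  qed (use pointwise in \<open>auto simp: indicator_def\<close>)
  finally show ?thesis .
qed

text \<open>The factorials amount to \<open>m * ((2 * m) choose m) \<le> m * 4 ^ m\<close>. After
  cancelling \<open>12 powr (m * p)\<close> it remains to see
  \<open>c * m * 4 ^ m \<le> 5 powr (m * p)\<close>, where \<open>c\<close> collects the factors
  free of \<open>m\<close>.\<close>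

lemma eventually_lower_bound:
  fixes p :: real
  assumes p: "1 < p"
  shows "\<forall>\<^sub>F m in sequentially.
     2 powr (1 - 2 * p * real m) * fact (2 * m)
            / (pi powr (p / 2 - 1) * real m powr (p / 2) * 3 powr (real m * p)
               * fact m * fact (m - 1))
     \<le> (5 / 12) powr (real m * p) * (200 * pi * real m) powr (- p / 2)"
proof -
  define c where "c = 2 / pi powr (p / 2 - 1) * (200 * pi) powr (p / 2)"
  have "(\<lambda>m. c * (real m * (4 / 5) ^ m)) \<longlonglongrightarrow> c * 0"
    by (intro tendsto_mult tendsto_const powser_times_n_limit_0) auto
  then have "\<forall>\<^sub>F m in sequentially. c * (real m * (4 / 5) ^ m) < 1"
    by (intro order_tendstoD) auto
  then show ?thesis
    using eventually_ge_at_top[of 1]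
  proof eventually_elim
    case (elim m)
    obtain k where m: "m = Suc k" using elim(2) by (cases m) auto
    have m_pos: "0 < real m" by (simp add: m)
    have fact_le: "fact (2 * m) / (fact m * fact (m - 1)) \<le> real m * 4 ^ m"
    proof -
      have "fact m = real m * fact (m - 1)" by (simp add: m)
      then have "fact (2 * m) / (fact m * fact (m - 1)) = real m * real ((2 * m) choose m)"
        using m_pos by (simp add: binomial_fact)
      also have "real ((2 * m) choose m) \<le> real (\<Sum>i\<le>2*m. (2 * m) choose i)"
        by (intro of_nat_mono member_le_sum) auto
      also have "\<dots> = 4 ^ m" by (simp add: choose_row_sum power_mult)
      finally show ?thesis using m_pos by simp
    qed
    have "c * (real m * 4 ^ m) \<le> 5 ^ m"
      using elim(1) by (simp add: power_divide field_simps)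
    also have "(5::real) ^ m = 5 powr (real m)" by (simp add: powr_realpow)
    \<comment> \<open>Here \<open>p > 1\<close> enters; the previous inequality is the limit
      \<open>m * (4 / 5) ^ m \<longlonglongrightarrow> 0\<close>.\<close>
    also have "\<dots> \<le> 5 powr (real m * p)"
      using p m_pos by (intro powr_mono) auto
    finally have key: "2 / pi powr (p / 2 - 1) * (real m * 4 ^ m) \<le> 5 powr (real m * p) * (200 * pi) powr (- p / 2)"
      by (simp add: c_def powr_minus_divide field_simps)
    have "2 powr (1 - 2 * p * real m) = 2 / 4 powr (real m * p)"
    proof -
      have "(4::real) powr (real m * p) = 2 powr (2 * p * real m)"
        using powr_powr[of 2 2 "real m * p"] by (simp add: mult_ac)
      then show ?thesis by (simp add: powr_diff)
    qed
    then have "2 powr (1 - 2 * p * real m) * fact (2 * m)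
            / (pi powr (p / 2 - 1) * real m powr (p / 2) * 3 powr (real m * p) * fact m * fact (m - 1))
        = 2 / pi powr (p / 2 - 1) * (fact (2 * m) / (fact m * fact (m - 1)))
           / (4 powr (real m * p) * 3 powr (real m * p) * real m powr (p / 2))"
      by simp
    also have "\<dots> \<le> 2 / pi powr (p / 2 - 1) * (real m * 4 ^ m)
           / (4 powr (real m * p) * 3 powr (real m * p) * real m powr (p / 2))"
      by (intro divide_right_mono mult_left_mono fact_le) auto
    also have "\<dots> \<le> 5 powr (real m * p) * (200 * pi) powr (- p / 2)
           / (4 powr (real m * p) * 3 powr (real m * p) * real m powr (p / 2))"
      by (intro divide_right_mono key) auto
    also have "\<dots> = (5 / 12) powr (real m * p) * (200 * pi * real m) powr (- p / 2)"
    proof -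
      have "4 powr (real m * p) * 3 powr (real m * p) = 12 powr (real m * p)"
        by (subst powr_mult[symmetric]) auto
      moreover have "(200 * pi * real m) powr (- p / 2) = (200 * pi) powr (- p / 2) / real m powr (p / 2)"
        by (simp add: powr_mult powr_minus_divide)
      ultimately show ?thesis by (simp add: powr_divide)
    qed
    finally show ?case .
  qed
qed

theorem theorem2:
  fixes p :: real
  assumes "1 < p"
  shows "\<exists>\<delta> :: nat \<Rightarrow> real.
    (\<forall>m. \<delta> m \<le> 1) \<and> \<delta> \<longlonglongrightarrow> 0 \<and>
    (\<forall>(m :: nat) (n :: nat) (\<psi> :: real \<Rightarrow> complex).
       1 \<le> m \<and> real n = real m * p \<and> even n \<and> daubechies_wavelet m \<psi> \<longrightarrow>
       (\<exists>(F :: real) (G :: real).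
          0 \<le> F \<and> 0 \<le> G \<and>
          F powr p =
            2 powr (1 - p / 2) / (pi powr (p * (real m + 1 / 2) - 1) * (real m * p - 1))
            + 2 powr (1 - p * (2 * real m - 1)) / (pi powr (p / 2 - 1) * fact (n - 1))
              * (\<Sum>i = 0..n div 2. (- 1) ^ i * (fact n / (fact (n - i) * fact i))
                    * (real n - 2 * real i) ^ (n - 1)) \<and>
          G powr p =
            (1 - \<delta> m) * 2 powr (1 - 2 * p * real m) * fact (2 * m)
            / (pi powr (p / 2 - 1) * real m powr (p / 2) * 3 powr (real m * p)
               * fact m * fact (m - 1)) \<and>
          integrable lborel (\<lambda>\<omega>. \<bar>\<omega>\<bar> powr (- (real m * p)) * cmod (fourier \<psi> \<omega>) powr p) \<and>
          G \<le> (LINT \<omega>|lborel. \<bar>\<omega>\<bar> powr (- (real m * p)) * cmod (fourier \<psi> \<omega>) powr p) powr (1 / p) \<and>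
          (LINT \<omega>|lborel. \<bar>\<omega>\<bar> powr (- (real m * p)) * cmod (fourier \<psi> \<omega>) powr p) powr (1 / p) \<le> F))"
proof -
  define lower where "lower m = 2 powr (1 - 2 * p * real m) * fact (2 * m)
            / (pi powr (p / 2 - 1) * real m powr (p / 2) * 3 powr (real m * p)
               * fact m * fact (m - 1))" for m
  obtain m0 where m0: "\<And>m. m0 \<le> m \<Longrightarrow>
      lower m \<le> (5 / 12) powr (real m * p) * (200 * pi * real m) powr (- p / 2)"
    using eventually_lower_bound[OF assms] unfolding lower_def eventually_sequentially by blast
  define \<delta> :: "nat \<Rightarrow> real" where "\<delta> m = (if m < m0 then 1 else 0)" for m
  have root: "(x powr (1 / p)) powr p = x" if "0 \<le> x" for x :: real
    using that assms by (simp add: powr_powr)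
  show ?thesis
  proof (intro exI[of _ \<delta>] conjI allI impI, goal_cases)
    case (1 m)
    show ?case by (simp add: \<delta>_def)
  next
    case 2
    have "\<forall>\<^sub>F m in sequentially. \<delta> m = 0"
      using eventually_ge_at_top[of m0] by eventually_elim (simp add: \<delta>_def)
    then show ?case by (rule tendsto_eventually)
  next
    case (3 m n \<psi>)
    then have m: "1 \<le> m" and n: "real n = real m * p" "even n" and \<psi>: "daubechies_wavelet m \<psi>"
      by auto
    let ?I = "LINT \<omega>|lborel. \<bar>\<omega>\<bar> powr (- (real m * p)) * cmod (fourier \<psi> \<omega>) powr p"
    define upper where "upper = 2 powr (1 - p / 2) / (pi powr (p * (real m + 1 / 2) - 1) * (real m * p - 1))
            + 2 powr (1 - p * (2 * real m - 1)) / (pi powr (p / 2 - 1) * fact (n - 1))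
              * (\<Sum>i = 0..n div 2. (- 1) ^ i * (fact n / (fact (n - i) * fact i))
                    * (real n - 2 * real i) ^ (n - 1))"
    note bound = weighted_wavelet_integral[OF \<psi> m assms n]
    have I_nonneg: "0 \<le> ?I" by (intro Bochner_Integration.integral_nonneg) simp
    have I_le: "?I \<le> upper" unfolding upper_def by (rule bound)
    have lower_nonneg: "0 \<le> (1 - \<delta> m) * lower m" by (auto simp: \<delta>_def lower_def)
    have lower_le: "(1 - \<delta> m) * lower m \<le> ?I"
    \<comment> \<open>Below \<open>m0\<close> the factor \<open>1 - \<delta> m\<close> is
      \<open>0\<close>, and nonnegativity of the integral suffices.\<close>
    proof (cases "m < m0")
      case False
      then show ?thesis
        using order_trans[OF m0 weighted_wavelet_integral_ge[OF \<psi> m assms bound(1)]]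
        by (simp add: \<delta>_def)
    qed (use I_nonneg in \<open>simp add: \<delta>_def\<close>)
    show ?case
    \<comment> \<open>Taking \<open>p\<close>-th roots needs nonnegative radicands; for
      \<open>upper\<close>, which contains an alternating sum, this follows from
      \<open>0 \<le> ?I \<le> upper\<close>.\<close>
    proof (rule exI[of _ "upper powr (1 / p)"], rule exI[of _ "((1 - \<delta> m) * lower m) powr (1 / p)"], intro conjI)
      show "(upper powr (1 / p)) powr p =
            2 powr (1 - p / 2) / (pi powr (p * (real m + 1 / 2) - 1) * (real m * p - 1))
            + 2 powr (1 - p * (2 * real m - 1)) / (pi powr (p / 2 - 1) * fact (n - 1))
              * (\<Sum>i = 0..n div 2. (- 1) ^ i * (fact n / (fact (n - i) * fact i))
                    * (real n - 2 * real i) ^ (n - 1))"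
        unfolding upper_def[symmetric] by (rule root[OF order_trans[OF I_nonneg I_le]])
      show "(((1 - \<delta> m) * lower m) powr (1 / p)) powr p =
            (1 - \<delta> m) * 2 powr (1 - 2 * p * real m) * fact (2 * m)
            / (pi powr (p / 2 - 1) * real m powr (p / 2) * 3 powr (real m * p)
               * fact m * fact (m - 1))"
        unfolding root[OF lower_nonneg] by (simp add: lower_def)
      show "((1 - \<delta> m) * lower m) powr (1 / p) \<le> ?I powr (1 / p)"
        using assms lower_nonneg lower_le by (intro powr_mono2) auto
      show "?I powr (1 / p) \<le> upper powr (1 / p)"
        using assms I_nonneg I_le by (intro powr_mono2) auto
    qed (use bound(1) in auto)
  qed
qed

end
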